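(* Let $\{F_t\}_{t\ge0}$ be a nice Feller process on $\mathbb{R}^d$, $d\ge1$, with symbol $q(x,\xi)$, and let $\Phi_t(x,\xi):=\mathbb{E}^{x}\left[e^{i\langle\xi,F_t-x\rangle}\right]$ for $t\ge0$ and $x,\xi\in\mathbb{R}^d$. Then for any $\varepsilon>0$ and any $\xi\in\mathbb{R}^d$ there exists $t_0=t_0(\varepsilon,\xi)>0$ such that for all $x\in\mathbb{R}^d$ and all $t\in[0,t_0]$, $$\operatorname{Re}\Phi_t(x,\xi)\ge\exp\left[-(2+\varepsilon)\,t\sup_{z\in\mathbb{R}^d}|q(z,\xi)|\right].$$
   Context: A Feller process $\{F_t\}_{t\ge0}$ on $\mathbb{R}^d$ is a Markov process with state space $(\mathbb{R}^d,\mathcal{B}(\mathbb{R}^d))$, with laws $\mathbb{P}^x$ and expectations $\mathbb{E}^x$ (starting point $x\in\mathbb{R}^d$), whose semigroup $P_tf(x)=\mathbb{E}^x[f(F_t)]$ maps $C_\infty(\mathbb{R}^d)$ (continuous functions vanishing at infinity, with the supremum norm) into itself and is strongly continuous there; it is strong Markov with càdlàg paths. Let $(\mathcal{A},\mathcal{D}_{\mathcal{A}})$ be its (Feller) generator. Condition (C1): $C_c^\infty(\mathbb{R}^d)\subseteq\mathcal{D}_{\mathcal{A}}$. Under (C1), for $f\in C_c^\infty(\mathbb{R}^d)$, $\mathcal{A}f(x)=-\int_{\mathbb{R}^d}q(x,\xi)e^{i\langle\xi,x\rangle}\hat f(\xi)\,d\xi$ with $\hat f(\xi)=(2\pi)^{-d}\int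 e^{-i\langle\xi,x\rangle}f(x)\,dx$, where the function $q:\mathbb{R}^d\times\mathbb{R}^d\to\mathbb{C}$, called the symbol, has for each $x$ the form $$q(x,\xi)=a(x)-i\langle\xi,b(x)\rangle+\tfrac12\langle\xi,c(x)\xi\rangle-\int_{\mathbb{R}^d}\left(e^{i\langle\xi,y\rangle}-1-i\langle\xi,y\rangle1_{\{|y|\le1\}}\right)\nu(x,dy),$$ with $a\ge0$, $b(x)\in\mathbb{R}^d$, $c(x)$ a symmetric nonnegative definite $d\times d$ matrix (all Borel measurable in $x$) and $\nu(x,dy)$ a Borel kernel (the Lévy measure) with $\nu(x,\{0\})=0$, $\int\min\{1,|y|^2\}\nu(x,dy)<\infty$. Condition (C2): there is $C\ge0$ with $\sup_x|q(x,\xi)|\le C(1+|\xi|^2)$ for all $\xi$. Condition (C3): $q(x,0)=a(x)=0$ for all $x$. The process is $\varphi$-irreducible, for a $\sigma$-finite measure $\varphi$ on $\mathcal{B}(\mathbb{R}^d)$, if $\varphi(B)>0$ implies $\int_0^\infty\mathbb{P}^x(F_t\in B)\,dt>0$ for all $x$; then there is a maximal irreducibility measure $\psi$ (i.e. the process is $\bar\varphi$-irreducible iff $\bar\varphi\ll\psi$). Condition (C4): the process is irreducible and its maximal irreducibility measure $\psi$ satisfies $\psi(O)>0$ for every nonempty open set $O\subseteq\mathbb{R}^d$. A nice Feller process is a Feller process satisfying (C1)-(C4). *)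

theory Defs
  imports "HOL-Probability.Probability"
begin

section \<open>Function spaces\<close>

definition C_infty :: "(real^'n \<Rightarrow> real) set" where
  "C_infty = {f. continuous_on UNIV f \<and> (f \<longlongrightarrow> 0) at_infinity}"

text \<open>Class \<open>C\<^sup>k\<close>: by recursion, all directional derivatives of a differentiable function are
  \<open>C\<^sup>k\<close>.\<close>

primrec C_k :: "nat \<Rightarrow> (real^'n \<Rightarrow> real) \<Rightarrow> bool" where
  "C_k 0 f \<longleftrightarrow> continuous_on UNIV f"
| "C_k (Suc k) f \<longleftrightarrow>
     (\<forall>x. f differentiable (at x)) \<and> (\<forall>v. C_k k (\<lambda>x. frechet_derivative f (at x) v))"

definition C_c_smooth :: "(real^'n \<Rightarrow> real) set" where
  "C_c_smooth = {f. (\<forall>k. C_k k f) \<and> compact (closure {x. f x \<noteq> 0})}"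

definition fourier :: "(real^'n \<Rightarrow> real) \<Rightarrow> real^'n \<Rightarrow> complex" where
  "fourier f \<xi> = complex_of_real (1 / (2 * pi) ^ CARD('n)) *
     (\<integral>x. iexp (- (\<xi> \<bullet> x)) * complex_of_real (f x) \<partial>lborel)"

section \<open>Feller processes\<close>

text \<open>A process consists of a measurable space \<open>M\<close> (only its carrier and sigma-algebra matter),
  laws \<open>P x\<close> on it, and coordinates \<open>F t\<close>, of which only those with \<open>t \<ge> 0\<close> matter.\<close>

definition nat_filtration :: "'w measure \<Rightarrow> (real \<Rightarrow> 'w \<Rightarrow> real^'n) \<Rightarrow> real \<Rightarrow> 'w measure" where
  "nat_filtration M F s =
     sigma (space M) {F u -` B \<inter> space M |u B. 0 \<le> u \<and> u \<le> s \<and> B \<in> sets borel}"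

definition markov_process ::
  "'w measure \<Rightarrow> (real^'n \<Rightarrow> 'w measure) \<Rightarrow> (real \<Rightarrow> 'w \<Rightarrow> real^'n) \<Rightarrow> bool" where
  "markov_process M P F \<longleftrightarrow>
     (\<forall>x. prob_space (P x) \<and> sets (P x) = sets M) \<and>
     (\<forall>t\<ge>0. F t \<in> measurable M borel) \<and>
     (\<forall>t\<ge>0. \<forall>B\<in>sets borel.
        (\<lambda>x. measure (P x) (F t -` B \<inter> space M)) \<in> borel_measurable borel) \<and>
     (\<forall>x. AE \<omega> in P x. F 0 \<omega> = x) \<and>
     (\<forall>x. \<forall>s\<ge>0. \<forall>t\<ge>0. \<forall>B\<in>sets borel. AE \<omega> in P x.
        real_cond_exp (P x) (nat_filtration M F s) (indicator (F (s + t) -` B \<inter> space M)) \<omega>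
          = measure (P (F s \<omega>)) (F t -` B \<inter> space M))"

definition cadlag :: "(real \<Rightarrow> real^'n) \<Rightarrow> bool" where
  "cadlag X \<longleftrightarrow> (\<forall>t\<ge>0. continuous (at_right t) X) \<and> (\<forall>t>0. \<exists>l. (X \<longlongrightarrow> l) (at_left t))"

definition feller_semigroup ::
  "(real^'n \<Rightarrow> 'w measure) \<Rightarrow> (real \<Rightarrow> 'w \<Rightarrow> real^'n) \<Rightarrow> real \<Rightarrow> (real^'n \<Rightarrow> real) \<Rightarrow> real^'n \<Rightarrow> real" where
  "feller_semigroup P F t f x = (\<integral>\<omega>. f (F t \<omega>) \<partial>P x)"

text \<open>The strong Markov property is not listed: it follows from the Feller property and the
  right-continuity of the paths. Strong continuity is convergence in the supremum norm at
  \<open>t = 0\<close>.\<close>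

definition feller_process ::
  "'w measure \<Rightarrow> (real^'n \<Rightarrow> 'w measure) \<Rightarrow> (real \<Rightarrow> 'w \<Rightarrow> real^'n) \<Rightarrow> bool" where
  "feller_process M P F \<longleftrightarrow>
     markov_process M P F \<and>
     (\<forall>\<omega>\<in>space M. cadlag (\<lambda>t. F t \<omega>)) \<and>
     (\<forall>t\<ge>0. \<forall>f\<in>C_infty. feller_semigroup P F t f \<in> C_infty) \<and>
     (\<forall>f\<in>C_infty. uniform_limit UNIV (\<lambda>t. feller_semigroup P F t f) f (at_right 0))"

text \<open>\<open>has_generator P F f g\<close>: \<open>f\<close> lies in the domain of the generator and is mapped to \<open>g\<close>.\<close>

definition has_generator ::
  "(real^'n \<Rightarrow> 'w measure) \<Rightarrow> (real \<Rightarrow> 'w \<Rightarrow> real^'n) \<Rightarrow> (real^'n \<Rightarrow> real) \<Rightarrow> (real^'n \<Rightarrow> real) \<Rightarrow> bool" where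
  "has_generator P F f g \<longleftrightarrow> f \<in> C_infty \<and> g \<in> C_infty \<and>
     uniform_limit UNIV (\<lambda>t x. (feller_semigroup P F t f x - f x) / t) g (at_right 0)"

definition generator_domain ::
  "(real^'n \<Rightarrow> 'w measure) \<Rightarrow> (real \<Rightarrow> 'w \<Rightarrow> real^'n) \<Rightarrow> (real^'n \<Rightarrow> real) set" where
  "generator_domain P F = {f. \<exists>g. has_generator P F f g}"

definition generator ::
  "(real^'n \<Rightarrow> 'w measure) \<Rightarrow> (real \<Rightarrow> 'w \<Rightarrow> real^'n) \<Rightarrow> (real^'n \<Rightarrow> real) \<Rightarrow> real^'n \<Rightarrow> real" where
  "generator P F f = (THE g. has_generator P F f g)"

section \<open>The symbol\<close>

definition levy_characteristics ::
  "(real^'n \<Rightarrow> real) \<Rightarrow> (real^'n \<Rightarrow> real^'n) \<Rightarrow> (real^'n \<Rightarrow> real^'n^'n) \<Rightarrow>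
   (real^'n \<Rightarrow> (real^'n) measure) \<Rightarrow> bool" where
  "levy_characteristics a b c \<nu> \<longleftrightarrow>
     a \<in> borel_measurable borel \<and> (\<forall>x. a x \<ge> 0) \<and>
     b \<in> borel_measurable borel \<and>
     c \<in> borel_measurable borel \<and>
     (\<forall>x. transpose (c x) = c x \<and> (\<forall>v. v \<bullet> (c x *v v) \<ge> 0)) \<and>
     (\<forall>x. sets (\<nu> x) = sets borel) \<and>
     (\<forall>B\<in>sets borel. (\<lambda>x. emeasure (\<nu> x) B) \<in> borel_measurable borel) \<and>
     (\<forall>x. emeasure (\<nu> x) {0} = 0 \<and> (\<integral>\<^sup>+y. ennreal (min 1 ((norm y)\<^sup>2)) \<partial>\<nu> x) < \<infinity>)"

definition levy_khintchine ::
  "(real^'n \<Rightarrow> real) \<Rightarrow> (real^'n \<Rightarrow> real^'n) \<Rightarrow> (real^'n \<Rightarrow> real^'n^'n) \<Rightarrow>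
   (real^'n \<Rightarrow> (real^'n) measure) \<Rightarrow> real^'n \<Rightarrow> real^'n \<Rightarrow> complex" where
  "levy_khintchine a b c \<nu> x \<xi> =
     complex_of_real (a x) - \<i> * complex_of_real (\<xi> \<bullet> b x)
     + complex_of_real (1/2 * (\<xi> \<bullet> (c x *v \<xi>)))
     - (\<integral>y. iexp (\<xi> \<bullet> y) - 1
            - \<i> * complex_of_real (\<xi> \<bullet> y) * indicator {y. norm y \<le> 1} y \<partial>\<nu> x)"

lemma levy_khintchine_0: "levy_khintchine a b c \<nu> x 0 = complex_of_real (a x)"
  by (simp add: levy_khintchine_def)

definition is_symbol ::
  "(real^'n \<Rightarrow> 'w measure) \<Rightarrow> (real \<Rightarrow> 'w \<Rightarrow> real^'n) \<Rightarrow> (real^'n \<Rightarrow> real^'n \<Rightarrow> complex) \<Rightarrow> bool" where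
  "is_symbol P F q \<longleftrightarrow>
     (\<exists>a b c \<nu>. levy_characteristics a b c \<nu> \<and> (\<forall>x \<xi>. q x \<xi> = levy_khintchine a b c \<nu> x \<xi>)) \<and>
     (\<forall>f\<in>C_c_smooth. \<forall>x. complex_of_real (generator P F f x)
        = - (\<integral>\<xi>. q x \<xi> * iexp (\<xi> \<bullet> x) * fourier f \<xi> \<partial>lborel))"

section \<open>Irreducibility\<close>

definition irreducible_wrt ::
  "(real^'n \<Rightarrow> 'w measure) \<Rightarrow> (real \<Rightarrow> 'w \<Rightarrow> real^'n) \<Rightarrow> (real^'n) measure \<Rightarrow> bool" where
  "irreducible_wrt P F \<phi> \<longleftrightarrow>
     sigma_finite_measure \<phi> \<and> sets \<phi> = sets borel \<and>
     (\<forall>B\<in>sets borel. emeasure \<phi> B > 0 \<longrightarrow>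
        (\<forall>x. (\<integral>\<^sup>+t\<in>{0..}. emeasure (P x) (F t -` B \<inter> space (P x)) \<partial>lborel) > 0))"

text \<open>The library's \<open>absolutely_continuous \<psi> \<phi>\<close> means that \<open>\<phi>\<close> is absolutely continuous with
  respect to \<open>\<psi>\<close>.\<close>

definition maximal_irreducibility_measure ::
  "(real^'n \<Rightarrow> 'w measure) \<Rightarrow> (real \<Rightarrow> 'w \<Rightarrow> real^'n) \<Rightarrow> (real^'n) measure \<Rightarrow> bool" where
  "maximal_irreducibility_measure P F \<psi> \<longleftrightarrow>
     irreducible_wrt P F \<psi> \<and>
     (\<forall>\<phi>. sigma_finite_measure \<phi> \<and> sets \<phi> = sets borel \<longrightarrow>
        (irreducible_wrt P F \<phi> \<longleftrightarrow> absolutely_continuous \<psi> \<phi>))"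

section \<open>Nice Feller processes\<close>

text \<open>The conditions after \<open>is_symbol\<close> and the domain condition: quadratic growth of the symbol
  uniformly in space; no killing, as \<open>q x 0\<close> is the killing rate \<open>a x\<close>
  (\<open>levy_khintchine_0\<close>); irreducibility with full topological support. Maximal irreducibility
  measures are mutually absolutely continuous, so the choice of \<open>\<psi>\<close> is immaterial.\<close>

definition nice_feller_process ::
  "'w measure \<Rightarrow> (real^'n \<Rightarrow> 'w measure) \<Rightarrow> (real \<Rightarrow> 'w \<Rightarrow> real^'n) \<Rightarrow>
   (real^'n \<Rightarrow> real^'n \<Rightarrow> complex) \<Rightarrow> bool" where
  "nice_feller_process M P F q \<longleftrightarrow>
     feller_process M P F \<and>
     C_c_smooth \<subseteq> generator_domain P F \<and>
     is_symbol P F q \<and>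
     (\<exists>C\<ge>0. \<forall>\<xi> x. cmod (q x \<xi>) \<le> C * (1 + (norm \<xi>)\<^sup>2)) \<and>
     (\<forall>x. q x 0 = 0) \<and>
     (\<exists>\<psi>. maximal_irreducibility_measure P F \<psi> \<and>
        (\<forall>U. open U \<and> U \<noteq> {} \<longrightarrow> emeasure \<psi> U > 0))"

definition char_fun ::
  "(real^'n \<Rightarrow> 'w measure) \<Rightarrow> (real \<Rightarrow> 'w \<Rightarrow> real^'n) \<Rightarrow> real \<Rightarrow> real^'n \<Rightarrow> real^'n \<Rightarrow> complex" where
  "char_fun P F t x \<xi> = (\<integral>\<omega>. iexp (\<xi> \<bullet> (F t \<omega> - x)) \<partial>P x)"

end

theory Submission
  imports Defs
begin

text \<open>Dynkin's formula extends from \<open>C_c_smooth\<close> to \<open>y \<mapsto> cos (\<xi> \<bullet> (y - x))\<close>, on which the generator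
  has modulus at most \<open>Q = (SUP z. cmod (q z \<xi>))\<close>; this gives \<open>\<bar>Re \<Phi>\<^sub>t(x,\<xi>) - 1\<bar> \<le> t Q\<close> uniformly in \<open>x\<close>,
  and \<open>1 - u \<ge> exp (- 2 u)\<close> for small \<open>u\<close>. The extension multiplies the cosine by the cut-offs
  \<open>cutoff k\<close>. The Fourier transform of the product is a rescaled copy of the fixed function
  \<open>cutoff_hat\<close>, concentrated at \<open>\<plusminus>\<xi>\<close>, so the Fourier representation of the generator converges to
  \<open>q\<close> at \<open>\<plusminus>\<xi>\<close>, boundedly because \<open>q\<close> grows at most quadratically and \<open>cutoff_hat\<close> decays fast.\<close>

section \<open>A smooth bump function\<close>

text \<open>The cosine does not vanish at infinity, so it is outside the domain of the generator,
  and the symbol is tied to the generator only on compactly supported functions. Cutting off spoils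
  the constant: the generator of cosine times cut-off is controlled uniformly only by a multiple of
  \<open>C * (1 + |\<xi>|^2)\<close>, which may be far above Q, and its convergence is obtained only
  pointwise. The bound by Q thus becomes available only in the limit. The obstacle is overcome by
  splitting off the part of the generator above Q, which tends to zero boundedly and disappears
  under expectation and time integral. The cut-offs are coordinate products of a one-dimensional
  bump rather than radial functions: their transforms factor, and decay and inversion have to be
  proved on the line only. The factor 2 in the exponent is the price of replacing
  \<open>1 - u\<close> by an exponential on the whole range \<open>u \<le> 1/2\<close>.\<close>

definition flat_exp :: "real poly \<Rightarrow> real \<Rightarrow> real" where
  "flat_exp p x = (if x > 0 then poly p (1 / x) * exp (- (1 / x)) else 0)"

lemma tendsto_poly_mult_exp_neg:
  fixes p :: "real poly"
  shows "((\<lambda>y. poly p y * exp (- y)) \<longlongrightarrow> 0) at_top"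
proof -
  have "((\<lambda>y. \<Sum>i\<le>degree p. coeff p i * (y ^ i / exp y)) \<longlongrightarrow> (\<Sum>i\<le>degree p. coeff p i * 0)) at_top"
    by (intro tendsto_intros tendsto_power_div_exp_0)
  then show ?thesis
    by (simp add: poly_altdef sum_distrib_right exp_minus divide_inverse mult.assoc)
qed

text \<open>With u = 1/x, the derivative of \<open>p(u) exp(-u)\<close> in x is
  \<open>u^2 (p(u) - p'(u)) exp(-u)\<close>. Treating all polynomials at once makes the family
  closed under differentiation, so smoothness at 0 follows by iteration.\<close>

lemma flat_exp_deriv:
  "(flat_exp p has_real_derivative flat_exp (monom 1 2 * (p - pderiv p)) x) (at x)"
proof (cases x "0::real" rule: linorder_cases)
  case less
  have "((\<lambda>_. 0) has_real_derivative 0) (at x)" by simp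
  moreover have "\<forall>\<^sub>F y in nhds x. flat_exp p y = 0"
    using eventually_nhds_in_open[of "{..<0}" x] less
    by (auto elim!: eventually_mono simp: flat_exp_def)
  ultimately show ?thesis
    using less by (subst DERIV_cong_ev) (auto simp: flat_exp_def)
next
  case greater
  have "((\<lambda>x. poly p (1 / x) * exp (- (1 / x))) has_real_derivative
      flat_exp (monom 1 2 * (p - pderiv p)) x) (at x)"
    using greater
    by (auto intro!: derivative_eq_intros DERIV_chain'[OF _ poly_DERIV]
        simp: flat_exp_def poly_monom field_simps power2_eq_square)
  moreover have "\<forall>\<^sub>F y in nhds x. flat_exp p y = poly p (1 / y) * exp (- (1 / y))"
    using eventually_nhds_in_open[of "{0<..}" x] greater
    by (auto elim!: eventually_mono simp: flat_exp_def)
  ultimately show ?thesis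
    by (subst DERIV_cong_ev) auto
next
  case equal
  \<comment> \<open>Dividing by y multiplies the polynomial in 1/y by its variable, which is
    \<open>pCons 0 p\<close>; the right difference quotient at 0 is therefore of the same decaying
    type.\<close>
  have *: "((\<lambda>y. poly (pCons 0 p) (inverse y) * exp (- inverse y)) \<longlongrightarrow> 0) (at_right (0::real))"
    by (rule filterlim_compose[OF tendsto_poly_mult_exp_neg filterlim_inverse_at_top_right])
  have "((\<lambda>y. flat_exp p y / y) \<longlongrightarrow> 0) (at_right 0)"
    by (rule Lim_transform_eventually[OF *])
      (auto simp: eventually_at_filter flat_exp_def field_simps)
  moreover have "((\<lambda>y. flat_exp p y / y) \<longlongrightarrow> 0) (at_left 0)"
    by (rule Lim_transform_eventually[OF tendsto_const])
      (auto simp: eventually_at_filter flat_exp_def)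
  ultimately have "((\<lambda>y. flat_exp p y / y) \<longlongrightarrow> 0) (at 0)"
    by (rule filterlim_split_at_real[rotated])
  then show ?thesis
    using equal by (simp add: has_field_derivative_iff flat_exp_def)
qed

lemma continuous_on_flat_exp [continuous_intros]:
  "continuous_on S f \<Longrightarrow> continuous_on S (\<lambda>x. flat_exp p (f x))"
  by (rule continuous_on_compose2[where t = UNIV and g = "flat_exp p"])
    (auto intro!: DERIV_continuous_on DERIV_subset[OF flat_exp_deriv])

text \<open>The span of these products is closed under differentiation.\<close>

inductive_set bump_span :: "(real \<Rightarrow> real) set" where
  base: "(\<lambda>x. flat_exp p (1 + x) * flat_exp r (1 - x)) \<in> bump_span"
| diff: "g \<in> bump_span \<Longrightarrow> h \<in> bump_span \<Longrightarrow> (\<lambda>x. g x - h x) \<in> bump_span"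

lemma bump_span_continuous: "g \<in> bump_span \<Longrightarrow> continuous_on S g"
  by (induction rule: bump_span.induct) (auto intro!: continuous_intros)

lemma bump_span_support: "g \<in> bump_span \<Longrightarrow> \<bar>x\<bar> \<ge> 1 \<Longrightarrow> g x = 0"
  by (induction rule: bump_span.induct) (auto simp: flat_exp_def)

text \<open>The inner derivative -1 of \<open>1 - x\<close> turns the product rule into a difference
  of two products, which is why \<open>diff\<close> is the closure operation of the span.\<close>

lemma bump_span_deriv:
  "g \<in> bump_span \<Longrightarrow> \<exists>g'\<in>bump_span. \<forall>x. (g has_real_derivative g' x) (at x)"
proof (induction rule: bump_span.induct)
  case (base p r)
  let ?d = "\<lambda>p::real poly. monom 1 2 * (p - pderiv p)"
  show ?case
  proof (intro bexI allI)
    fix x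
    have "((\<lambda>x. flat_exp p (1 + x)) has_real_derivative flat_exp (?d p) (1 + x) * 1) (at x)"
      by (rule DERIV_chain'[where g = "flat_exp p", rotated, OF flat_exp_deriv])
         (auto intro!: derivative_eq_intros)
    moreover have "((\<lambda>x. flat_exp r (1 - x)) has_real_derivative flat_exp (?d r) (1 - x) * (-1)) (at x)"
      by (rule DERIV_chain'[where g = "flat_exp r", rotated, OF flat_exp_deriv])
         (auto intro!: derivative_eq_intros)
    ultimately show "((\<lambda>x. flat_exp p (1 + x) * flat_exp r (1 - x)) has_real_derivative
        flat_exp (?d p) (1 + x) * flat_exp r (1 - x) - flat_exp p (1 + x) * flat_exp (?d r) (1 - x)) (at x)"
      by (auto intro!: derivative_eq_intros)
  qed (intro bump_span.intros)
next
  case (diff g h)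
  then obtain g' h' where "g' \<in> bump_span" "h' \<in> bump_span"
      "\<And>x. (g has_real_derivative g' x) (at x)" "\<And>x. (h has_real_derivative h' x) (at x)"
    by auto
  then show ?case
    by (intro bexI[of _ "\<lambda>x. g' x - h' x"]) (auto intro!: bump_span.intros derivative_intros)
qed

text \<open>On (-1,1) this is the classical mollifier \<open>exp(2 - 2/(1 - x^2))\<close>. The
  constants e normalise the value at 0 to 1, which becomes both the limit of the cut-offs and the
  total mass of their transform.\<close>

definition bump :: "real \<Rightarrow> real" where
  "bump x = flat_exp [:exp 1:] (1 + x) * flat_exp [:exp 1:] (1 - x)"

lemma bump_in_span: "bump \<in> bump_span"
  unfolding bump_def[abs_def] by (rule bump_span.base)

lemma bump_0: "bump 0 = 1"
  by (simp add: bump_def flat_exp_def flip: exp_add)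

lemma bump_support: "\<bar>x\<bar> \<ge> 1 \<Longrightarrow> bump x = 0"
  by (rule bump_span_support[OF bump_in_span])

lemma bump_nonneg: "bump x \<ge> 0" by (simp add: bump_def flat_exp_def)

lemma bump_le_1: "bump x \<le> 1"
proof (cases "\<bar>x\<bar> < 1")
  case True
  then have "1 + x > 0" "1 - x > 0"
    by auto
  then have "bump x = exp (2 - 1 / (1 + x) - 1 / (1 - x))"
    by (simp add: bump_def flat_exp_def flip: exp_add)
  moreover have "1 / (1 + x) + 1 / (1 - x) = 2 / (1 - x\<^sup>2)"
    using True by (auto simp: field_simps power2_eq_square)
  moreover have "2 \<le> 2 / (1 - x\<^sup>2)"
    using True by (simp add: field_simps abs_square_less_1)
  ultimately show ?thesis by simp
qed (use bump_support[of x] in simp)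

section \<open>Stability properties of the classes \<open>C\<^sup>k\<close>\<close>

lemma C_k_SucI:
  assumes "\<And>x. (f has_derivative f' x) (at x)" "\<And>v. C_k k (\<lambda>x. f' x v)"
  shows "C_k (Suc k) f"
proof -
  have "frechet_derivative f (at x) = f' x" for x
    using frechet_derivative_at[OF assms(1)] by simp
  then show ?thesis
    using assms by (auto simp: differentiable_def)
qed

text \<open>Serves the product rule, where the factor left undifferentiated has to drop by one
  class.\<close>

lemma C_k_SucD: "C_k (Suc k) f \<Longrightarrow> C_k k f"
proof (induction k arbitrary: f)
  case 0
  then show ?case
    by (auto intro!: continuous_at_imp_continuous_on differentiable_imp_continuous_within)
qed auto

lemma C_k_const: "C_k k (\<lambda>x. c)"
proof (induction k arbitrary: c)
  case (Suc k)
  show ?case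
    by (rule C_k_SucI[where f' = "\<lambda>x v. 0"]) (auto intro: Suc)
qed simp

lemma C_k_add: "C_k k f \<Longrightarrow> C_k k g \<Longrightarrow> C_k k (\<lambda>x. f x + g x)"
proof (induction k arbitrary: f g)
  case (Suc k)
  have "(f has_derivative frechet_derivative f (at x)) (at x)"
       "(g has_derivative frechet_derivative g (at x)) (at x)" for x
    using Suc.prems by (auto simp: frechet_derivative_works)
  then show ?case
    using Suc by (intro C_k_SucI[OF has_derivative_add]) auto
qed (auto intro: continuous_intros)

lemma C_k_mult: "C_k k f \<Longrightarrow> C_k k g \<Longrightarrow> C_k k (\<lambda>x. f x * g x)"
proof (induction k arbitrary: f g)
  case (Suc k)
  have "(f has_derivative frechet_derivative f (at x)) (at x)"
       "(g has_derivative frechet_derivative g (at x)) (at x)" for x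
    using Suc.prems by (auto simp: frechet_derivative_works)
  then have "((\<lambda>x. f x * g x) has_derivative
      (\<lambda>v. f x * frechet_derivative g (at x) v + frechet_derivative f (at x) v * g x)) (at x)" for x
    by (intro has_derivative_mult) auto
  then show ?case
    using Suc.prems C_k_SucD[OF Suc.prems(1)] C_k_SucD[OF Suc.prems(2)]
    by (elim C_k_SucI) (auto intro!: C_k_add Suc.IH)
qed (auto intro: continuous_intros)

lemma C_k_prod: "finite I \<Longrightarrow> (\<And>i. i \<in> I \<Longrightarrow> C_k k (f i)) \<Longrightarrow> C_k k (\<lambda>x. \<Prod>i\<in>I. f i x)"
  by (induction rule: finite_induct) (simp_all add: C_k_const C_k_mult)

text \<open>\<open>H m\<close> is the m-th derivative of a function on the line. A derivative in
  direction w contributes only the constant \<open>v \<bullet> w\<close> and passes to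
  \<open>H (Suc m)\<close>, so the induction on k must leave m free.\<close>

lemma C_k_compose_affine:
  assumes "\<And>m x. (H m has_real_derivative H (Suc m) x) (at x)"
  shows "C_k k (\<lambda>x. H m (v \<bullet> x + c))"
proof (induction k arbitrary: m)
  case 0
  have "continuous_on UNIV (H m)"
    by (rule DERIV_continuous_on[OF DERIV_subset[OF assms]]) simp
  then show ?case
    by (auto intro!: continuous_intros elim!: continuous_on_compose2[where g = "H m"])
next
  case (Suc k)
  show ?case
  proof (rule C_k_SucI)
    show "((\<lambda>x. H m (v \<bullet> x + c)) has_derivative (\<lambda>w. H (Suc m) (v \<bullet> x + c) * (v \<bullet> w))) (at x)" for x
    proof (rule has_derivative_compose[OF _ assms[of m, THEN has_field_derivative_imp_has_derivative]])
      show "((\<lambda>x. v \<bullet> x + c) has_derivative (\<bullet>) v) (at x)"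
        by (auto intro!: derivative_eq_intros)
    qed
    show "C_k k (\<lambda>x. H (Suc m) (v \<bullet> x + c) * (v \<bullet> w))" for w
      by (intro C_k_mult C_k_const Suc)
  qed
qed

lemma C_k_flat_exp: "C_k k (\<lambda>x. flat_exp p (v \<bullet> x + c))"
  using C_k_compose_affine[where H = "\<lambda>m. flat_exp (((\<lambda>p. monom 1 2 * (p - pderiv p)) ^^ m) p)" and m = 0
      and k = k and v = v and c = c] flat_exp_deriv
  by simp

lemma C_k_cos: "C_k k (\<lambda>x. cos (v \<bullet> x + c))"
proof -
  \<comment> \<open>Each differentiation shifts the phase by \<pi>/2, so one formula covers all
    derivatives.\<close>
  have "((\<lambda>x. cos (x + m * (pi / 2))) has_real_derivative cos (x + Suc m * (pi / 2))) (at x)"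
    for m :: nat and x :: real
  proof -
    have "cos (x + Suc m * (pi / 2)) = - sin (x + m * (pi / 2))"
      using cos_add[of "x + real m * (pi / 2)" "pi / 2"] by (simp add: field_simps)
    then show ?thesis
      by (auto intro!: derivative_eq_intros simp del: of_nat_Suc)
  qed
  from C_k_compose_affine[where H = "\<lambda>m x. cos (x + real m * (pi / 2))" and m = 0, OF this]
  show ?thesis by simp
qed

text \<open>The product form, against a radial cut-off, lets the Fourier integral split into
  integrals over the coordinates.\<close>

definition cutoff :: "real \<Rightarrow> real^'n \<Rightarrow> real" where
  "cutoff r y = (\<Prod>i\<in>UNIV. bump (y $ i / r))"

lemma C_k_cutoff: "C_k k (cutoff r)"
proof -
  have 1: "C_k k (\<lambda>x::real^'n. flat_exp p (1 + x $ i / r))" for p :: "real poly" and i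
    using C_k_flat_exp[of k p "axis i (1 / r)" 1] by (simp add: inner_axis' add.commute)
  have 2: "C_k k (\<lambda>x::real^'n. flat_exp p (1 - x $ i / r))" for p :: "real poly" and i
    using C_k_flat_exp[of k p "axis i (- 1 / r)" 1] by (simp add: inner_axis' add.commute)
  show ?thesis
    unfolding cutoff_def[abs_def] bump_def by (intro C_k_prod C_k_mult 1 2) auto
qed

text \<open>The cut-off lives on the cube of half-side r, where the l1 norm, hence the Euclidean
  norm, is at most r times the dimension.\<close>

lemma cutoff_support: "r > 0 \<Longrightarrow> norm y > real CARD('n) * r \<Longrightarrow> cutoff r (y :: real^'n) = 0"
proof (rule ccontr)
  assume r: "r > 0" "norm y > real CARD('n) * r" and "cutoff r y \<noteq> 0"
  then have "\<bar>y $ i / r\<bar> < 1" for i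
    using bump_support[of "y $ i / r"] by (force simp: cutoff_def)
  then have "\<bar>y $ i\<bar> \<le> r" for i
    using r by (simp add: field_simps less_imp_le)
  then have "(\<Sum>i\<in>UNIV. \<bar>y $ i\<bar>) \<le> real CARD('n) * r"
    by (intro sum_bounded_above[where A = UNIV, simplified])
  with norm_le_l1_cart[of y] r show False by linarith
qed

lemma cutoff_bounds: "0 \<le> cutoff r y" "cutoff r y \<le> 1"
  by (auto simp: cutoff_def bump_nonneg bump_le_1 intro!: prod_nonneg prod_le_1)

lemma cutoff_tendsto: "(\<lambda>k. cutoff (real (Suc k)) (y :: real^'n)) \<longlonglongrightarrow> 1"
proof -
  have "(\<lambda>k. \<Prod>i\<in>UNIV. bump (y $ i / real (Suc k))) \<longlonglongrightarrow> (\<Prod>i\<in>(UNIV :: 'n set). bump 0)"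
  proof (intro tendsto_prod)
    fix i
    have "(\<lambda>k. y $ i / real (Suc k)) \<longlonglongrightarrow> 0"
      by (rule LIMSEQ_Suc[OF lim_const_over_n])
    then show "(\<lambda>k. bump (y $ i / real (Suc k))) \<longlonglongrightarrow> bump 0"
      using continuous_on_tendsto_compose[of UNIV bump] bump_span_continuous[OF bump_in_span]
      by auto
  qed
  then show ?thesis by (simp add: cutoff_def bump_0)
qed

lemma cos_cutoff_in_C_c_smooth:
  assumes "r > 0" shows "(\<lambda>y. cos (\<xi> \<bullet> y + c) * cutoff r y) \<in> C_c_smooth"
proof -
  have "{y. cos (\<xi> \<bullet> y + c) * cutoff r y \<noteq> 0} \<subseteq> cball 0 (real CARD('a) * r)"
    using cutoff_support[OF assms] by (force simp: not_le)
  then have "bounded {y. cos (\<xi> \<bullet> y + c) * cutoff r y \<noteq> 0}"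
    by (rule bounded_subset[OF bounded_cball])
  then show ?thesis
    by (auto simp: C_c_smooth_def compact_closure intro: C_k_mult C_k_cos C_k_cutoff)
qed

section \<open>Fourier decay and inversion in dimension one\<close>

text \<open>Same normalisation as \<open>fourier\<close>: with the factor in the forward transform,
  inversion at 0 carries no constant.\<close>

definition fourier1 :: "(real \<Rightarrow> real) \<Rightarrow> real \<Rightarrow> complex" where
  "fourier1 g \<eta> = complex_of_real (1 / (2 * pi)) * (\<integral>x. iexp (- (\<eta> * x)) * complex_of_real (g x) \<partial>lborel)"

lemma integrable_bounded_support:
  fixes f :: "real \<Rightarrow> 'a::{banach, second_countable_topology}"
  assumes [measurable]: "f \<in> borel_measurable borel"
    and "\<And>x. norm (f x) \<le> K" "\<And>x. \<bar>x\<bar> \<ge> 1 \<Longrightarrow> f x = 0"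
  shows "integrable lborel f"
proof (rule Bochner_Integration.integrable_bound)
  show "integrable lborel (\<lambda>x::real. indicator {-1..1} x *\<^sub>R K)"
    by (intro integrable_real_indicator integrable_scaleR_left) auto
  show "AE x in lborel. norm (f x) \<le> norm (indicator {-1..1} x *\<^sub>R K)"
  proof (intro AE_I2)
    fix x :: real
    show "norm (f x) \<le> norm (indicator {-1..1} x *\<^sub>R K)"
      using assms(2)[of x] assms(3)[of x] by (cases "x \<in> {-1..1}") auto
  qed
qed simp

lemma bump_span_measurable: "g \<in> bump_span \<Longrightarrow> g \<in> borel_measurable borel"
  by (rule borel_measurable_continuous_onI) (rule bump_span_continuous)

lemma bump_span_bounded:
  assumes "g \<in> bump_span" obtains K where "\<And>x. \<bar>g x\<bar> \<le> K"
proof -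
  have "bounded (g ` {-1..1})"
    by (intro compact_imp_bounded compact_continuous_image bump_span_continuous assms) simp
  then obtain K where K: "\<And>x. x \<in> {-1..1} \<Longrightarrow> \<bar>g x\<bar> \<le> K"
    unfolding bounded_iff by (metis imageI real_norm_def)
  have "\<bar>g x\<bar> \<le> max K 0" for x
    using K[of x] bump_span_support[OF assms, of x] by (cases "x \<in> {-1..1}") (auto simp: le_max_iff_disj)
  then show thesis by (rule that)
qed

lemma bump_span_fourier_integrable:
  assumes "g \<in> bump_span"
  shows "integrable lborel (\<lambda>x. iexp (\<eta> * x) * complex_of_real (g x))"
proof -
  obtain K where "\<And>x. \<bar>g x\<bar> \<le> K" using bump_span_bounded[OF assms] by blast
  with assms bump_span_measurable[OF assms] show ?thesis
    by (intro integrable_bounded_support[where K = K]) (auto simp: norm_mult bump_span_support)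
qed

lemma bump_span_fourier_bounded:
  assumes "g \<in> bump_span" obtains K where "\<And>\<eta>. cmod (fourier1 g \<eta>) \<le> K"
proof -
  have "cmod (fourier1 g \<eta>) \<le> 1 / (2 * pi) * (\<integral>x. \<bar>g x\<bar> \<partial>lborel)" for \<eta>
  proof -
    have "cmod (\<integral>x. iexp (- (\<eta> * x)) * complex_of_real (g x) \<partial>lborel)
        \<le> (\<integral>x. cmod (iexp (- (\<eta> * x)) * complex_of_real (g x)) \<partial>lborel)"
      by (rule integral_norm_bound)
    then show ?thesis
      by (simp add: fourier1_def norm_mult norm_divide) (simp add: divide_simps)
  qed
  then show thesis by (rule that)
qed

lemma fourier1_deriv:
  assumes g: "g \<in> bump_span" and g': "g' \<in> bump_span"
    and deriv: "\<And>x. (g has_real_derivative g' x) (at x)"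
  shows "fourier1 g' \<eta> = \<i> * \<eta> * fourier1 g \<eta>"
proof -
  \<comment> \<open>f is the derivative of \<open>exp(-i \<eta> x) g(x)\<close>. Its integral over
    [-1,1] is zero because g vanishes at both endpoints: integration by parts without boundary
    terms.\<close>
  define f where "f x = iexp (- (\<eta> * x)) * complex_of_real (g' x)
      - \<i> * \<eta> * (iexp (- (\<eta> * x)) * complex_of_real (g x))" for x
  have "(\<integral>x. indicator {-1..1} x *\<^sub>R f x \<partial>lborel)
      = iexp (- (\<eta> * 1)) * complex_of_real (g 1) - iexp (- (\<eta> * (-1))) * complex_of_real (g (-1))"
  proof (rule integral_FTC_Icc)
    fix x :: real
    have "((\<lambda>x. iexp (- (\<eta> * x))) has_vector_derivative (iexp (- (\<eta> * x)) * (\<i> * (- \<eta>)))) (at x)"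
    proof -
      have "((\<lambda>z. exp (\<i> * - (complex_of_real \<eta> * z))) has_field_derivative
          exp (\<i> * - (complex_of_real \<eta> * x)) * (\<i> * (- \<eta>))) (at (complex_of_real x))"
        by (auto intro!: derivative_eq_intros)
      from has_vector_derivative_real_field[OF this] show ?thesis by simp
    qed
    moreover have "((\<lambda>x. complex_of_real (g x)) has_vector_derivative complex_of_real (g' x)) (at x)"
      using deriv[of x] by (simp add: has_vector_derivative_of_real has_real_derivative_iff_has_vector_derivative)
    ultimately have "((\<lambda>x. iexp (- (\<eta> * x)) * complex_of_real (g x)) has_vector_derivative f x) (at x)"
      using has_vector_derivative_mult by (fastforce simp: f_def algebra_simps)
    then show "((\<lambda>x. iexp (- (\<eta> * x)) * complex_of_real (g x)) has_vector_derivative f x) (at x within {-1..1})"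
      by (rule has_vector_derivative_at_within)
  next
    show "continuous_on {-1..1} f"
      unfolding f_def by (intro continuous_intros bump_span_continuous g g')
  qed simp
  also have "\<dots> = 0"
    using bump_span_support[OF g] by simp
  also have "(\<lambda>x. indicator {-1..1} x *\<^sub>R f x) = f"
    using bump_span_support[OF g] bump_span_support[OF g'] by (auto simp: f_def indicator_def fun_eq_iff)
  finally have "(\<integral>x. f x \<partial>lborel) = 0" .
  moreover have "(\<integral>x. f x \<partial>lborel) = (\<integral>x. iexp (- (\<eta> * x)) * complex_of_real (g' x) \<partial>lborel)
      - \<i> * \<eta> * (\<integral>x. iexp (- (\<eta> * x)) * complex_of_real (g x) \<partial>lborel)"
    unfolding f_def
    using bump_span_fourier_integrable[OF g, of "- \<eta>"] bump_span_fourier_integrable[OF g', of "- \<eta>"]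
    by (subst Bochner_Integration.integral_diff) auto
  ultimately show ?thesis by (simp add: fourier1_def)
qed

text \<open>Each derivative of g buys one power of \<eta>, and the span contains all derivatives;
  hence the induction over every g at once.\<close>

lemma fourier1_decay:
  "g \<in> bump_span \<Longrightarrow> \<exists>K. \<forall>\<eta>. \<bar>\<eta>\<bar> ^ m * cmod (fourier1 g \<eta>) \<le> K"
proof (induction m arbitrary: g)
  case 0
  obtain K where "\<And>\<eta>. cmod (fourier1 g \<eta>) \<le> K"
    using bump_span_fourier_bounded[OF 0] by blast
  then show ?case by auto
next
  case (Suc m)
  obtain g' where g': "g' \<in> bump_span" "\<And>x. (g has_real_derivative g' x) (at x)"
    using bump_span_deriv[OF Suc.prems] by blast
  obtain K where "\<And>\<eta>. \<bar>\<eta>\<bar> ^ m * cmod (fourier1 g' \<eta>) \<le> K"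
    using Suc.IH[OF g'(1)] by blast
  then show ?case
    by (auto intro!: exI[of _ K] simp: fourier1_deriv[OF Suc.prems g'] norm_mult mult_ac)
qed

lemma integrable_inverse_1_plus_square: "integrable lborel (\<lambda>x::real. inverse (1 + x\<^sup>2))"
proof -
  have "set_integrable lborel (einterval (-\<infinity>) \<infinity>) (\<lambda>x. inverse (1 + x\<^sup>2))"
    by (rule interval_integral_FTC_nonneg[where F = arctan and A = "- (pi / 2)" and B = "pi / 2"])
       (auto intro!: derivative_eq_intros continuous_intros tendsto_arctan_at_top tendsto_arctan_at_bot
         simp: add_nonneg_eq_0_iff ereal_tendsto_simps)
  then show ?thesis by (simp add: set_integrable_def)
qed

lemma fourier1_continuous:
  assumes "g \<in> bump_span" shows "continuous_on UNIV (fourier1 g)"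
proof -
  obtain K where K: "\<And>x. \<bar>g x\<bar> \<le> K" using bump_span_bounded[OF assms] by blast
  have int: "integrable lborel (\<lambda>x. \<bar>g x\<bar>)"
    using assms K bump_span_measurable[OF assms]
    by (intro integrable_bounded_support[where K = K]) (auto simp: bump_span_support)
  have [measurable]: "g \<in> borel_measurable borel" using assms by (rule bump_span_measurable)
  have "(\<lambda>n. \<integral>x. iexp (- (s n * x)) * complex_of_real (g x) \<partial>lborel) \<longlonglongrightarrow>
        (\<integral>x. iexp (- (\<eta> * x)) * complex_of_real (g x) \<partial>lborel)" if "s \<longlonglongrightarrow> \<eta>" for s \<eta>
    by (rule integral_dominated_convergence[where w = "\<lambda>x. \<bar>g x\<bar>"])
      (auto intro!: tendsto_intros that int simp: norm_mult)
  then show ?thesis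
    by (auto simp: fourier1_def[abs_def] continuous_on_sequentially comp_def intro!: tendsto_divide)
qed

lemma fourier1_measurable: "g \<in> bump_span \<Longrightarrow> fourier1 g \<in> borel_measurable borel"
  by (rule borel_measurable_continuous_onI) (rule fourier1_continuous)

text \<open>The weight matches the quadratic growth of the symbol. Decay of order four pays for it
  and leaves the integrable majorant \<open>1/(1 + \<eta>^2)\<close>, because
  \<open>(1 + \<eta>^2)^2 \<le> 2 (1 + \<eta>^4)\<close>.\<close>

lemma fourier1_weighted_integrable:
  assumes "g \<in> bump_span"
  shows "integrable lborel (\<lambda>\<eta>. (1 + \<eta>\<^sup>2) * cmod (fourier1 g \<eta>))"
proof -
  obtain K0 where K0: "\<And>\<eta>. cmod (fourier1 g \<eta>) \<le> K0"
    using fourier1_decay[OF assms, of 0] by auto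
  obtain K4 where K4: "\<And>\<eta>. \<bar>\<eta>\<bar> ^ 4 * cmod (fourier1 g \<eta>) \<le> K4"
    using fourier1_decay[OF assms, of 4] by auto
  note [measurable] = fourier1_measurable[OF assms]
  show ?thesis
  proof (rule Bochner_Integration.integrable_bound)
    show "integrable lborel (\<lambda>\<eta>::real. (2 * (K0 + K4)) * inverse (1 + \<eta>\<^sup>2))"
      by (intro integrable_mult_right integrable_inverse_1_plus_square)
    have "(1 + \<eta>\<^sup>2) * cmod (fourier1 g \<eta>) \<le> (2 * (K0 + K4)) * inverse (1 + \<eta>\<^sup>2)" for \<eta>
    proof -
      have pos: "1 + \<eta>\<^sup>2 > 0" by (simp add: add_pos_nonneg)
      have "(1 + \<eta>\<^sup>2)\<^sup>2 \<le> 2 * (1 + \<bar>\<eta>\<bar> ^ 4)"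
        using sum_squares_ge_zero[of "\<eta>\<^sup>2 - 1" 0] by (simp add: power2_eq_square algebra_simps power4_eq_xxxx)
      then have "(1 + \<eta>\<^sup>2)\<^sup>2 * cmod (fourier1 g \<eta>) \<le> 2 * (1 + \<bar>\<eta>\<bar> ^ 4) * cmod (fourier1 g \<eta>)"
        by (rule mult_right_mono) simp
      also have "\<dots> \<le> 2 * (K0 + K4)"
        using K0[of \<eta>] K4[of \<eta>] by (simp add: algebra_simps)
      finally show ?thesis
        using pos by (simp add: divide_simps power2_eq_square mult_ac flip: divide_inverse)
    qed
    moreover have "0 \<le> (1 + \<eta>\<^sup>2) * cmod (fourier1 g \<eta>)" for \<eta>
      by simp
    ultimately show "AE \<eta> in lborel. norm ((1 + \<eta>\<^sup>2) * cmod (fourier1 g \<eta>))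
        \<le> norm ((2 * (K0 + K4)) * inverse (1 + \<eta>\<^sup>2))"
      by (intro AE_I2) (metis abs_of_nonneg order_trans real_norm_def)
  qed measurable
qed

lemma fourier1_integrable:
  assumes "g \<in> bump_span" shows "integrable lborel (fourier1 g)"
proof (rule Bochner_Integration.integrable_bound[OF fourier1_weighted_integrable[OF assms]])
  have "1 * cmod (fourier1 g \<eta>) \<le> (1 + \<eta>\<^sup>2) * cmod (fourier1 g \<eta>)" for \<eta>
    by (intro mult_right_mono) auto
  then show "AE \<eta> in lborel. cmod (fourier1 g \<eta>) \<le> norm ((1 + \<eta>\<^sup>2) * cmod (fourier1 g \<eta>))"
    by (simp add: abs_mult)
qed (use fourier1_measurable[OF assms] in simp)

text \<open>The transform of \<open>g\<close> is tested against the Gaussian \<open>exp (- (\<eta> / n)\<^sup>2 / 2)\<close>; by Fubini this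
  is the expectation of \<open>g (Z / n)\<close> for a standard normal \<open>Z\<close>.\<close>

lemma fourier1_gaussian:
  assumes g: "g \<in> bump_span" and n: "n > 0"
  shows "(\<integral>\<eta>. exp (- (\<eta> / n)\<^sup>2 / 2) *\<^sub>R fourier1 g \<eta> \<partial>lborel)
       = (\<integral>s. complex_of_real (std_normal_density s * g (s / n)) \<partial>lborel)"
proof -
  note [measurable] = bump_span_measurable[OF g]
  obtain K where K: "\<And>x. \<bar>g x\<bar> \<le> K" using bump_span_bounded[OF g] by blast
  have int_g: "integrable lborel (\<lambda>x. \<bar>g x\<bar>)"
    using g K
    by (intro integrable_bounded_support[where K = K]) (auto simp: bump_span_support)
  have int_gauss: "integrable lborel (\<lambda>\<eta>. exp (- (\<eta> / n)\<^sup>2 / 2))"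
  proof -
    have "integrable lborel (\<lambda>s. sqrt (2 * pi) * std_normal_density (0 + 1 / n * s))"
      using n by (intro integrable_mult_right lborel_integrable_real_affine) auto
    then show ?thesis by (simp add: std_normal_density_def)
  qed
  define h where "h \<eta> x = exp (- (\<eta> / n)\<^sup>2 / 2) *\<^sub>R (iexp (- (\<eta> * x)) * complex_of_real (g x))" for \<eta> x
  have h_meas: "case_prod h \<in> borel_measurable (lborel \<Otimes>\<^sub>M lborel)"
    unfolding h_def by measurable
  have norm_h: "cmod (h \<eta> x) = exp (- (\<eta> / n)\<^sup>2 / 2) * \<bar>g x\<bar>" for \<eta> x
    by (simp add: h_def norm_mult)
  have int_h: "integrable (lborel \<Otimes>\<^sub>M lborel) (case_prod h)"
  proof (rule lborel_pair.Fubini_integrable[OF h_meas])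
    show "integrable lborel (\<lambda>\<eta>. \<integral>x. norm (case (\<eta>, x) of (x, xa) \<Rightarrow> h x xa) \<partial>lborel)"
      using int_gauss by (simp add: norm_h)
    show "AE \<eta> in lborel. integrable lborel (\<lambda>x. case (\<eta>, x) of (x, xa) \<Rightarrow> h x xa)"
      using bump_span_fourier_integrable[OF g, of "- _"] by (auto simp: h_def intro!: AE_I2 integrable_scaleR_right)
  qed
  \<comment> \<open>The substitution \<eta> = n s turns the Gaussian integral into the
    characteristic function of the standard normal law at -n x, which is again Gaussian.\<close>
  have inner: "(\<integral>\<eta>. h \<eta> x \<partial>lborel) = n * sqrt (2 * pi) * exp (- (n * x)\<^sup>2 / 2) * g x" for x
  proof -
    have "(\<integral>\<eta>. h \<eta> x \<partial>lborel) = \<bar>n\<bar> *\<^sub>R (\<integral>s. h (0 + n * s) x \<partial>lborel)"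
      using n by (intro lborel_integral_real_affine) simp
    also have "(\<integral>s. h (0 + n * s) x \<partial>lborel)
        = (\<integral>s. (sqrt (2 * pi) * g x) *\<^sub>R (std_normal_density s *\<^sub>R iexp ((- (n * x)) * s)) \<partial>lborel)"
      using n by (intro Bochner_Integration.integral_cong)
        (auto simp: h_def std_normal_density_def scaleR_conv_of_real mult_ac)
    also have "\<dots> = (sqrt (2 * pi) * g x) *\<^sub>R char std_normal_distribution (- (n * x))"
      by (simp only: integral_scaleR_right) (simp add: char_def integral_density)
    also have "\<dots> = (sqrt (2 * pi) * g x) *\<^sub>R complex_of_real (exp (- (n * x)\<^sup>2 / 2))"
      by (simp add: char_std_normal_distribution)
    finally show ?thesis
      using n by (simp add: scaleR_conv_of_real mult_ac)
  qed
  have "(\<integral>\<eta>. exp (- (\<eta> / n)\<^sup>2 / 2) *\<^sub>R fourier1 g \<eta> \<partial>lborel)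
      = (\<integral>\<eta>. complex_of_real (1 / (2 * pi)) * (\<integral>x. h \<eta> x \<partial>lborel) \<partial>lborel)"
    by (intro Bochner_Integration.integral_cong) (auto simp: fourier1_def h_def scaleR_conv_of_real)
  also have "\<dots> = complex_of_real (1 / (2 * pi)) * (\<integral>\<eta>. (\<integral>x. h \<eta> x \<partial>lborel) \<partial>lborel)"
    by simp
  also have "(\<integral>\<eta>. (\<integral>x. h \<eta> x \<partial>lborel) \<partial>lborel) = (\<integral>x. (\<integral>\<eta>. h \<eta> x \<partial>lborel) \<partial>lborel)"
    using lborel_pair.Fubini_integral[OF int_h] by simp
  \<comment> \<open>The factor \<open>1/(2\<pi>)\<close> of the transform and the
    \<open>sqrt(2\<pi>)\<close> from the Gaussian integral combine to the constant of the normal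
    density.\<close>
  also have "complex_of_real (1 / (2 * pi)) * (\<integral>x. (\<integral>\<eta>. h \<eta> x \<partial>lborel) \<partial>lborel)
      = (\<integral>x. complex_of_real (n * (std_normal_density (n * x) * g x)) \<partial>lborel)"
    unfolding inner
    by (subst integral_mult_right_zero[symmetric], intro Bochner_Integration.integral_cong)
      (auto simp: std_normal_density_def real_sqrt_mult field_simps simp flip: of_real_mult)
  also have "\<dots> = (\<integral>s. complex_of_real (std_normal_density s * g (s / n)) \<partial>lborel)"
    using n by (subst (2) lborel_integral_real_affine[where c = n and t = 0])
       (auto simp: scaleR_conv_of_real simp flip: integral_mult_right_zero)
  finally show ?thesis .
qed

text \<open>Both sides are limits of the Gaussian-damped integral as n grows: the damping tends to 1
  against an integrable transform, while the expectation of \<open>g(Z/n)\<close> tends to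
  \<open>g 0\<close> by continuity. Applied to \<open>bump\<close>, this gives
  \<open>cutoff_hat\<close> total mass 1.\<close>

lemma fourier1_inversion_0:
  assumes g: "g \<in> bump_span"
  shows "(\<integral>\<eta>. fourier1 g \<eta> \<partial>lborel) = g 0"
proof (rule LIMSEQ_unique)
  note [measurable] = bump_span_measurable[OF g] fourier1_measurable[OF g]
  obtain K where K: "\<And>x. \<bar>g x\<bar> \<le> K" using bump_span_bounded[OF g] by blast
  show "(\<lambda>k. \<integral>\<eta>. exp (- (\<eta> / real (Suc k))\<^sup>2 / 2) *\<^sub>R fourier1 g \<eta> \<partial>lborel)
      \<longlonglongrightarrow> (\<integral>\<eta>. fourier1 g \<eta> \<partial>lborel)"
  proof (rule integral_dominated_convergence[where w = "\<lambda>\<eta>. cmod (fourier1 g \<eta>)"])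
    show "AE \<eta> in lborel. (\<lambda>k. exp (- (\<eta> / real (Suc k))\<^sup>2 / 2) *\<^sub>R fourier1 g \<eta>) \<longlonglongrightarrow> fourier1 g \<eta>"
    proof (intro AE_I2)
      fix \<eta> :: real
      have "(\<lambda>k. exp (- (\<eta> / real (Suc k))\<^sup>2 / 2) *\<^sub>R fourier1 g \<eta>) \<longlonglongrightarrow> exp (- 0\<^sup>2 / 2) *\<^sub>R fourier1 g \<eta>"
        by (intro tendsto_intros LIMSEQ_Suc[OF lim_const_over_n]) simp
      then show "(\<lambda>k. exp (- (\<eta> / real (Suc k))\<^sup>2 / 2) *\<^sub>R fourier1 g \<eta>) \<longlonglongrightarrow> fourier1 g \<eta>"
        by simp
    qed
  qed (auto intro!: integrable_norm fourier1_integrable[OF g] mult_left_le_one_le)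
  have "(\<lambda>k. \<integral>s. complex_of_real (std_normal_density s * g (s / real (Suc k))) \<partial>lborel)
      \<longlonglongrightarrow> (\<integral>s. complex_of_real (std_normal_density s * g 0) \<partial>lborel)"
  proof (rule integral_dominated_convergence[where w = "\<lambda>s. std_normal_density s * K"])
    show "AE s in lborel. (\<lambda>k. complex_of_real (std_normal_density s * g (s / real (Suc k))))
        \<longlonglongrightarrow> complex_of_real (std_normal_density s * g 0)"
    proof (intro AE_I2 tendsto_of_real tendsto_mult tendsto_const)
      fix s :: real
      have "(\<lambda>k. s / real (Suc k)) \<longlonglongrightarrow> 0"
        by (rule LIMSEQ_Suc[OF lim_const_over_n])
      then show "(\<lambda>k. g (s / real (Suc k))) \<longlonglongrightarrow> g 0"
        using continuous_on_tendsto_compose[of UNIV g] bump_span_continuous[OF g] by auto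
    qed
  qed (auto simp: norm_mult intro!: mult_left_mono K)
  also have "(\<integral>s. complex_of_real (std_normal_density s * g 0) \<partial>lborel) = g 0"
    by (simp add: integral_density)
  finally show "(\<lambda>k. \<integral>\<eta>. exp (- (\<eta> / real (Suc k))\<^sup>2 / 2) *\<^sub>R fourier1 g \<eta> \<partial>lborel) \<longlonglongrightarrow> g 0"
    by (subst fourier1_gaussian[OF g]) auto
qed

section \<open>The Fourier transform of the cut-off\<close>

text \<open>Lebesgue measure on a Euclidean space is the image of the product of one-dimensional
  Lebesgue measures under the map from coordinates to vectors, so Fubini for finite products
  applies.\<close>

lemma
  fixes f :: "'a::euclidean_space \<Rightarrow> real \<Rightarrow> 'b::{real_normed_field, banach, second_countable_topology}"
  assumes "\<And>b. b \<in> Basis \<Longrightarrow> integrable lborel (f b)"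
  shows integrable_lborel_prod_Basis: "integrable lborel (\<lambda>x. \<Prod>b\<in>Basis. f b (x \<bullet> b))"
    and integral_lborel_prod_Basis:
      "(\<integral>x. (\<Prod>b\<in>Basis. f b (x \<bullet> b)) \<partial>lborel) = (\<Prod>b\<in>Basis. \<integral>x. f b x \<partial>lborel)"
proof -
  interpret product_sigma_finite "\<lambda>_::'a. lborel :: real measure" ..
  have [measurable]: "f b \<in> borel_measurable borel" if "b \<in> Basis" for b
    using borel_measurable_integrable[OF assms[OF that]] by simp
  have proj: "(\<Prod>b\<in>Basis. f b ((\<Sum>b\<in>Basis. g b *\<^sub>R b) \<bullet> b)) = (\<Prod>b\<in>Basis. f b (g b))" for g
    by (intro prod.cong) (auto simp: inner_sum_left inner_Basis if_distrib sum.delta cong: if_cong)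
  show "integrable lborel (\<lambda>x. \<Prod>b\<in>Basis. f b (x \<bullet> b))"
    by (subst lborel_eq, subst integrable_distr_eq)
       (auto simp: proj intro!: product_integrable_prod assms)
  show "(\<integral>x. (\<Prod>b\<in>Basis. f b (x \<bullet> b)) \<partial>lborel) = (\<Prod>b\<in>Basis. \<integral>x. f b x \<partial>lborel)"
    by (subst lborel_eq, subst integral_distr)
       (auto simp: proj intro!: product_integral_prod assms)
qed

lemma prod_Basis_vec:
  fixes f :: "real^'n \<Rightarrow> 'b::comm_monoid_mult"
  shows "(\<Prod>b\<in>Basis. f b) = (\<Prod>i\<in>UNIV. f (axis i 1))"
proof -
  have inj: "inj (\<lambda>i. axis i (1::real) :: real^'n)"
    by (auto simp: inj_on_def axis_eq_axis)
  have "(Basis :: (real^'n) set) = range (\<lambda>i. axis i 1)"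
    by (auto simp: Basis_vec_def)
  then show ?thesis
    using prod.reindex[OF inj, of f] by (simp add: o_def)
qed

lemma
  fixes f :: "'n::finite \<Rightarrow> real \<Rightarrow> 'b::{real_normed_field, banach, second_countable_topology}"
  assumes int: "\<And>i. integrable lborel (f i)"
  shows integrable_lborel_prod_vec: "integrable lborel (\<lambda>x::real^'n. \<Prod>i\<in>UNIV. f i (x $ i))"
    and integral_lborel_prod_vec:
      "(\<integral>x. (\<Prod>i\<in>UNIV. f i ((x :: real^'n) $ i)) \<partial>lborel) = (\<Prod>i\<in>UNIV. \<integral>x. f i x \<partial>lborel)"
proof -
  \<comment> \<open>The factors above are labelled by basis vectors; inverting \<open>axis\<close>
    relabels them by indices.\<close>
  define g where "g b = f (inv (\<lambda>i. axis i (1::real) :: real^'n) b)" for b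
  have "inj (\<lambda>i. axis i (1::real) :: real^'n)"
    by (auto simp: inj_on_def axis_eq_axis)
  from inv_f_f[OF this] have g: "g (axis i 1) = f i" for i
    by (simp add: g_def)
  have "integrable lborel (g b)" for b by (simp add: g_def int)
  then show "integrable lborel (\<lambda>x::real^'n. \<Prod>i\<in>UNIV. f i (x $ i))"
    "(\<integral>x. (\<Prod>i\<in>UNIV. f i ((x :: real^'n) $ i)) \<partial>lborel) = (\<Prod>i\<in>UNIV. \<integral>x. f i x \<partial>lborel)"
    using integrable_lborel_prod_Basis[of g] integral_lborel_prod_Basis[of g]
    by (simp_all add: prod_Basis_vec g inner_axis)
qed

text \<open>This is the transform \<open>fourier (cutoff 1)\<close> in factored form.\<close>

definition cutoff_hat :: "real^'n \<Rightarrow> complex" where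
  "cutoff_hat \<eta> = (\<Prod>i\<in>UNIV. fourier1 bump (\<eta> $ i))"

lemma cutoff_hat_measurable [measurable]: "cutoff_hat \<in> borel_measurable borel"
proof -
  have [measurable]: "(\<lambda>\<eta>::real^'n. fourier1 bump (\<eta> $ i)) \<in> borel_measurable borel" for i
    by (rule borel_measurable_continuous_onI)
      (intro continuous_on_compose2[OF fourier1_continuous[OF bump_in_span]] continuous_intros, simp)
  show ?thesis unfolding cutoff_hat_def[abs_def] by measurable
qed

lemma integral_cutoff_hat: "(\<integral>\<eta>. cutoff_hat \<eta> \<partial>lborel) = 1"
  using fourier1_integrable[OF bump_in_span] fourier1_inversion_0[OF bump_in_span]
  by (simp add: cutoff_hat_def integral_lborel_prod_vec[of "\<lambda>i. fourier1 bump"] bump_0)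

text \<open>\<open>1 + |\<eta>|^2\<close> is at most the product of the
  \<open>1 + \<eta>_i^2\<close>, so the weight factors along with the transform and each coordinate
  is covered by the one-dimensional estimate.\<close>

lemma cutoff_hat_weighted_integrable:
  "integrable lborel (\<lambda>\<eta>::real^'n. (1 + (norm \<eta>)\<^sup>2) * cmod (cutoff_hat \<eta>))"
proof (rule Bochner_Integration.integrable_bound)
  show "integrable lborel (\<lambda>\<eta>::real^'n. \<Prod>i\<in>UNIV. (1 + (\<eta> $ i)\<^sup>2) * cmod (fourier1 bump (\<eta> $ i)))"
    by (rule integrable_lborel_prod_vec) (rule fourier1_weighted_integrable[OF bump_in_span])
  have sum_prod: "1 + (\<Sum>i\<in>I. a i) \<le> (\<Prod>i\<in>I. 1 + a i)" if "finite I" "\<And>i. a i \<ge> 0"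
    for I :: "'n set" and a :: "'n \<Rightarrow> real"
    using that
  proof (induction I rule: finite_induct)
    case (insert j I)
    have "1 + (a j + sum a I) \<le> (1 + a j) * (1 + sum a I)"
      using insert.prems by (simp add: algebra_simps sum_nonneg)
    also have "\<dots> \<le> (1 + a j) * (\<Prod>i\<in>I. 1 + a i)"
      using insert by (intro mult_left_mono) auto
    finally show ?case using insert by simp
  qed simp
  have "1 + (norm \<eta>)\<^sup>2 \<le> (\<Prod>i\<in>UNIV. 1 + (\<eta> $ i)\<^sup>2)" for \<eta> :: "real^'n"
    using sum_prod[of UNIV "\<lambda>i. (\<eta> $ i)\<^sup>2"]
    by (simp add: norm_vec_def L2_set_def sum_nonneg)
  then have "(1 + (norm \<eta>)\<^sup>2) * cmod (cutoff_hat \<eta>)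
      \<le> (\<Prod>i\<in>UNIV. (1 + (\<eta> $ i)\<^sup>2) * cmod (fourier1 bump (\<eta> $ i)))" for \<eta> :: "real^'n"
    by (simp add: cutoff_hat_def prod.distrib flip: prod_norm) (intro mult_right_mono prod_nonneg, auto)
  moreover have "\<bar>(1 + (norm \<eta>)\<^sup>2) * cmod (cutoff_hat \<eta>)\<bar> = (1 + (norm \<eta>)\<^sup>2) * cmod (cutoff_hat \<eta>)" for \<eta> :: "real^'n"
    by (simp add: abs_mult)
  ultimately show "AE \<eta>::real^'n in lborel. norm ((1 + (norm \<eta>)\<^sup>2) * cmod (cutoff_hat \<eta>))
      \<le> norm (\<Prod>i\<in>UNIV. (1 + (\<eta> $ i)\<^sup>2) * cmod (fourier1 bump (\<eta> $ i)))"
    by (intro AE_I2) (simp only: real_norm_def order_trans[OF _ abs_ge_self])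
qed measurable

lemma iexp_inner_prod: "iexp (\<xi> \<bullet> (x :: real^'n)) = (\<Prod>i\<in>UNIV. iexp (\<xi> $ i * x $ i))"
  by (simp only: inner_vec_def of_real_sum sum_distrib_left exp_sum[OF finite_class.finite_UNIV]) simp

lemma bump_scaled_fourier:
  fixes \<eta> r :: real
  assumes "r > 0"
  shows "integrable lborel (\<lambda>x. iexp (- (\<eta> * x)) * complex_of_real (bump (x / r)))"
    and "(\<integral>x. iexp (- (\<eta> * x)) * complex_of_real (bump (x / r)) \<partial>lborel)
         = 2 * pi * r * fourier1 bump (r * \<eta>)"
proof -
  have int: "integrable lborel (\<lambda>x. iexp (- (r * \<eta>) * x) * complex_of_real (bump x))"
    by (rule bump_span_fourier_integrable[OF bump_in_span])
  show "integrable lborel (\<lambda>x. iexp (- (\<eta> * x)) * complex_of_real (bump (x / r)))"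
    using lborel_integrable_real_affine[OF int, of "1 / r" 0] assms by simp
  show "(\<integral>x. iexp (- (\<eta> * x)) * complex_of_real (bump (x / r)) \<partial>lborel)
         = 2 * pi * r * fourier1 bump (r * \<eta>)"
    using assms
    by (subst lborel_integral_real_affine[where c = r and t = 0])
      (auto simp: fourier1_def scaleR_conv_of_real mult_ac)
qed

text \<open>Modulation by \<xi> shifts the frequency, and dilation by r contracts it with one factor
  r per coordinate. The complex exponential is treated first because, unlike the cosine, it factors
  over the coordinates.\<close>

lemma fourier_modulated_cutoff:
  fixes \<xi> \<eta> :: "real^'n"
  assumes r: "r > 0"
  shows "integrable lborel (\<lambda>x. iexp (- (\<eta> \<bullet> x)) * (iexp (\<xi> \<bullet> x) * complex_of_real (cutoff r x)))" (is ?int)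
    and "(\<integral>x. iexp (- (\<eta> \<bullet> x)) * (iexp (\<xi> \<bullet> x) * complex_of_real (cutoff r x)) \<partial>lborel)
       = (2 * pi) ^ CARD('n) * (complex_of_real (r ^ CARD('n)) * cutoff_hat (r *\<^sub>R (\<eta> - \<xi>)))" (is ?eq)
proof -
  have eq: "iexp (- (\<eta> \<bullet> x)) * (iexp (\<xi> \<bullet> x) * complex_of_real (cutoff r x))
      = (\<Prod>i\<in>UNIV. iexp (- ((\<eta> $ i - \<xi> $ i) * x $ i)) * complex_of_real (bump (x $ i / r)))" for x
  proof -
    have "iexp (- (\<eta> \<bullet> x)) * iexp (\<xi> \<bullet> x) = iexp ((\<xi> - \<eta>) \<bullet> x)"
      by (simp add: inner_diff_left algebra_simps flip: exp_add)
    then show ?thesis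
      by (simp only: mult.assoc[symmetric]) 
        (simp add: cutoff_def iexp_inner_prod prod.distrib left_diff_distrib)
  qed
  show ?int unfolding eq
    by (rule integrable_lborel_prod_vec) (rule bump_scaled_fourier[OF r])
  have "(\<integral>x. iexp (- (\<eta> \<bullet> x)) * (iexp (\<xi> \<bullet> x) * complex_of_real (cutoff r x)) \<partial>lborel)
      = (\<Prod>i\<in>UNIV. \<integral>x. iexp (- ((\<eta> $ i - \<xi> $ i) * x)) * complex_of_real (bump (x / r)) \<partial>lborel)"
    unfolding eq by (rule integral_lborel_prod_vec) (rule bump_scaled_fourier[OF r])
  then show ?eq
    unfolding bump_scaled_fourier(2)[OF r] by (simp add: cutoff_hat_def prod.distrib power_mult_distrib)
qed

lemma fourier_cos_cutoff:
  fixes \<xi> \<eta> :: "real^'n"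
  assumes r: "r > 0"
  shows "fourier (\<lambda>y. cos (\<xi> \<bullet> y + c) * cutoff r y) \<eta>
    = iexp c / 2 * (complex_of_real (r ^ CARD('n)) * cutoff_hat (r *\<^sub>R (\<eta> - \<xi>)))
    + iexp (- c) / 2 * (complex_of_real (r ^ CARD('n)) * cutoff_hat (r *\<^sub>R (\<eta> - (- \<xi>))))"
proof -
  define E where "E \<zeta> x = iexp (- (\<eta> \<bullet> x)) * (iexp (\<zeta> \<bullet> x) * complex_of_real (cutoff r x))" for \<zeta> x
  note E = fourier_modulated_cutoff[OF r, of \<eta>, folded E_def]
  have "iexp (- (\<eta> \<bullet> x)) * complex_of_real (cos (\<xi> \<bullet> x + c) * cutoff r x)
      = iexp c / 2 * E \<xi> x + iexp (- c) / 2 * E (- \<xi>) x" for x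
    by (simp add: E_def cos_exp_eq exp_add[symmetric] field_simps flip: cos_of_real)
  then have "(\<integral>x. iexp (- (\<eta> \<bullet> x)) * complex_of_real (cos (\<xi> \<bullet> x + c) * cutoff r x) \<partial>lborel)
      = iexp c / 2 * (\<integral>x. E \<xi> x \<partial>lborel) + iexp (- c) / 2 * (\<integral>x. E (- \<xi>) x \<partial>lborel)"
    using E(1)[of \<xi>] E(1)[of "- \<xi>"] by simp
  then show ?thesis
    unfolding E(2) by (simp add: fourier_def field_simps)
qed

section \<open>Change of variables and approximate identities\<close>

lemma
  fixes f :: "'a::euclidean_space \<Rightarrow> 'b::{banach, second_countable_topology}"
  assumes r: "r > 0" and [measurable]: "f \<in> borel_measurable borel"
  shows integral_lborel_rescale:
      "(\<integral>x. f (r *\<^sub>R (x - t)) \<partial>lborel) = (1 / r ^ DIM('a)) *\<^sub>R (\<integral>s. f s \<partial>lborel)"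
    and integrable_lborel_rescale:
      "integrable lborel (\<lambda>x. f (r *\<^sub>R (x - t))) \<longleftrightarrow> integrable lborel f"
proof -
  have "lborel = density (distr lborel borel (\<lambda>s::'a. t + (1 / r) *\<^sub>R s)) (\<lambda>_. \<bar>1 / r\<bar> ^ DIM('a))"
    using r by (intro lborel_affine) simp
  moreover have "ennreal (1 / r) ^ k = ennreal ((1 / r) ^ k)" for k
    using r by (simp add: ennreal_power)
  ultimately have eq: "lborel = density (distr lborel borel (\<lambda>s::'a. t + (1 / r) *\<^sub>R s)) (\<lambda>_. ennreal ((1 / r) ^ DIM('a)))"
    using r by simp
  have pos: "(1 / r) ^ DIM('a) > 0" using r by simp
  show "(\<integral>x. f (r *\<^sub>R (x - t)) \<partial>lborel) = (1 / r ^ DIM('a)) *\<^sub>R (\<integral>s. f s \<partial>lborel)"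
    using r pos by (subst eq) (simp add: integral_density integral_distr power_one_over)
  show "integrable lborel (\<lambda>x. f (r *\<^sub>R (x - t))) \<longleftrightarrow> integrable lborel f"
  proof -
    have "integrable lborel (\<lambda>x. f (r *\<^sub>R (x - t))) \<longleftrightarrow> integrable lborel (\<lambda>s. (1 / r) ^ DIM('a) *\<^sub>R f s)"
      using r pos by (subst eq) (simp add: integrable_density integrable_distr_eq)
    also have "\<dots> \<longleftrightarrow> integrable lborel f"
      using integrable_scaleR_right[of "r ^ DIM('a)" lborel "\<lambda>s. (1 / r) ^ DIM('a) *\<^sub>R f s"]
        integrable_scaleR_right[of "(1 / r) ^ DIM('a)" lborel f] r
      by (auto simp: power_one_over)
    finally show ?thesis .
  qed
qed

text \<open>\<open>\<eta> \<mapsto> r ^ CARD('n) * cutoff_hat (r (\<eta> - \<xi>))\<close> is an approximate identity at \<open>\<xi>\<close>, also for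
  integrands of quadratic growth.\<close>

context
  fixes p :: "real^'n \<Rightarrow> complex" and C :: real
  assumes p_cont: "continuous_on UNIV p" and p_bound: "\<And>\<eta>. cmod (p \<eta>) \<le> C * (1 + (norm \<eta>)\<^sup>2)"
begin

lemma quadratic_growth_measurable [measurable]: "p \<in> borel_measurable borel"
  using p_cont by (rule borel_measurable_continuous_onI)

lemma shifted_product_measurable [measurable]: "(\<lambda>s. p (\<xi> + s /\<^sub>R r) * cutoff_hat s) \<in> borel_measurable borel"
  by measurable

lemma quadratic_growth_const_nonneg: "C \<ge> 0"
  using order_trans[OF norm_ge_zero p_bound[of 0]] by simp

text \<open>For \<open>r \<ge> 1\<close> the quadratic weight at \<xi> + s/r is absorbed into the
  product of the weights at \<xi> and at s. The majorant is free of r, so it serves both the uniform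
  bound and dominated convergence.\<close>

lemma shifted_product_bound:
  assumes "r \<ge> 1"
  shows "cmod (p (\<xi> + s /\<^sub>R r) * cutoff_hat s) \<le> 2 * C * (1 + (norm \<xi>)\<^sup>2) * ((1 + (norm s)\<^sup>2) * cmod (cutoff_hat s))"
proof -
  have "norm (s /\<^sub>R r) \<le> norm s"
    using assms mult_right_mono[of 1 r "norm s"] by (simp add: field_simps)
  then have "norm (\<xi> + s /\<^sub>R r) \<le> norm \<xi> + norm s"
    by (rule norm_triangle_le[OF add_left_mono])
  then have "(norm (\<xi> + s /\<^sub>R r))\<^sup>2 \<le> (norm \<xi> + norm s)\<^sup>2"
    by (rule power_mono) simp
  also have "\<dots> \<le> 2 * (norm \<xi>)\<^sup>2 + 2 * (norm s)\<^sup>2"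
    using sum_squares_bound[of "norm \<xi>" "norm s"] by (simp add: power2_sum)
  also have "\<dots> \<le> 2 * (1 + (norm \<xi>)\<^sup>2) * (1 + (norm s)\<^sup>2) - 1"
    by (simp add: algebra_simps)
  finally have "1 + (norm (\<xi> + s /\<^sub>R r))\<^sup>2 \<le> 2 * (1 + (norm \<xi>)\<^sup>2) * (1 + (norm s)\<^sup>2)"
    by simp
  then have "C * (1 + (norm (\<xi> + s /\<^sub>R r))\<^sup>2) \<le> C * (2 * (1 + (norm \<xi>)\<^sup>2) * (1 + (norm s)\<^sup>2))"
    using quadratic_growth_const_nonneg by (rule mult_left_mono)
  with p_bound[of "\<xi> + s /\<^sub>R r"]
  have "cmod (p (\<xi> + s /\<^sub>R r)) \<le> C * (2 * (1 + (norm \<xi>)\<^sup>2) * (1 + (norm s)\<^sup>2))"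
    by linarith
  then have "cmod (p (\<xi> + s /\<^sub>R r)) * cmod (cutoff_hat s)
      \<le> C * (2 * (1 + (norm \<xi>)\<^sup>2) * (1 + (norm s)\<^sup>2)) * cmod (cutoff_hat s)"
    by (rule mult_right_mono) simp
  then show ?thesis by (simp add: norm_mult mult_ac)
qed

lemma shifted_product_bound_integrable:
  "integrable lborel (\<lambda>s::real^'n. 2 * C * (1 + (norm \<xi>)\<^sup>2) * ((1 + (norm s)\<^sup>2) * cmod (cutoff_hat s)))"
  by (intro integrable_mult_right cutoff_hat_weighted_integrable)

lemma shifted_product_integrable:
  "r \<ge> 1 \<Longrightarrow> integrable lborel (\<lambda>s. p (\<xi> + s /\<^sub>R r) * cutoff_hat s)"
proof (rule Bochner_Integration.integrable_bound[OF shifted_product_bound_integrable[of \<xi>]])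
  assume "r \<ge> 1"
  from shifted_product_bound[OF this]
  show "AE s in lborel. norm (p (\<xi> + s /\<^sub>R r) * cutoff_hat s)
      \<le> norm (2 * C * (1 + (norm \<xi>)\<^sup>2) * ((1 + (norm s)\<^sup>2) * cmod (cutoff_hat s)))"
    by (intro AE_I2) (simp only: real_norm_def order_trans[OF _ abs_ge_self])
qed simp

lemma approx_identity_integral:
  assumes "r \<ge> 1"
  shows "(\<integral>\<eta>. p \<eta> * (complex_of_real (r ^ CARD('n)) * cutoff_hat (r *\<^sub>R (\<eta> - \<xi>))) \<partial>lborel)
       = (\<integral>s. p (\<xi> + s /\<^sub>R r) * cutoff_hat s \<partial>lborel)"
    and "integrable lborel (\<lambda>\<eta>. p \<eta> * (complex_of_real (r ^ CARD('n)) * cutoff_hat (r *\<^sub>R (\<eta> - \<xi>))))"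
proof -
  define f where "f s = complex_of_real (r ^ CARD('n)) * (p (\<xi> + s /\<^sub>R r) * cutoff_hat s)" for s
  have f: "p \<eta> * (complex_of_real (r ^ CARD('n)) * cutoff_hat (r *\<^sub>R (\<eta> - \<xi>))) = f (r *\<^sub>R (\<eta> - \<xi>))" for \<eta>
    using assms by (simp add: f_def)
  have [measurable]: "f \<in> borel_measurable borel"
    unfolding f_def by measurable
  show "(\<integral>\<eta>. p \<eta> * (complex_of_real (r ^ CARD('n)) * cutoff_hat (r *\<^sub>R (\<eta> - \<xi>))) \<partial>lborel)
       = (\<integral>s. p (\<xi> + s /\<^sub>R r) * cutoff_hat s \<partial>lborel)"
  proof -
    have "(1 / r ^ CARD('n)) *\<^sub>R (complex_of_real (r ^ CARD('n)) * z) = z" for z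
      using assms by (simp add: scaleR_conv_of_real)
    moreover have "(\<integral>s. f s \<partial>lborel) = complex_of_real (r ^ CARD('n)) * (\<integral>s. p (\<xi> + s /\<^sub>R r) * cutoff_hat s \<partial>lborel)"
      unfolding f_def by (rule integral_mult_right_zero)
    ultimately show ?thesis
      using assms unfolding f by (subst integral_lborel_rescale) simp_all
  qed
  show "integrable lborel (\<lambda>\<eta>. p \<eta> * (complex_of_real (r ^ CARD('n)) * cutoff_hat (r *\<^sub>R (\<eta> - \<xi>))))"
    using assms shifted_product_integrable[OF assms, of \<xi>] unfolding f
    by (subst integrable_lborel_rescale) (auto simp: f_def[abs_def])
qed

text \<open>The bound depends on p only through C, so with p built from the symbol at a point z it
  holds for all z simultaneously.\<close>

lemma approx_identity_bound:
  assumes "r \<ge> 1"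
  shows "cmod (\<integral>s. p (\<xi> + s /\<^sub>R r) * cutoff_hat s \<partial>lborel)
     \<le> 2 * C * (1 + (norm \<xi>)\<^sup>2) * (\<integral>s. (1 + (norm s)\<^sup>2) * cmod (cutoff_hat (s :: real^'n)) \<partial>lborel)"
proof -
  have "cmod (\<integral>s. p (\<xi> + s /\<^sub>R r) * cutoff_hat s \<partial>lborel)
      \<le> (\<integral>s. 2 * C * (1 + (norm \<xi>)\<^sup>2) * ((1 + (norm s)\<^sup>2) * cmod (cutoff_hat (s :: real^'n))) \<partial>lborel)"
    by (intro order_trans[OF integral_norm_bound integral_mono] integrable_norm
        shifted_product_integrable shifted_product_bound_integrable shifted_product_bound assms)
  then show ?thesis by simp
qed

lemma approx_identity_tendsto:
  "(\<lambda>k. \<integral>s. p (\<xi> + s /\<^sub>R real (Suc k)) * cutoff_hat s \<partial>lborel) \<longlonglongrightarrow> p \<xi>"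
proof -
  have "(\<lambda>k. \<integral>s. p (\<xi> + s /\<^sub>R real (Suc k)) * cutoff_hat s \<partial>lborel)
      \<longlonglongrightarrow> (\<integral>s. p \<xi> * cutoff_hat (s :: real^'n) \<partial>lborel)"
  proof (rule integral_dominated_convergence[OF _ _ shifted_product_bound_integrable[of \<xi>]])
    show "AE s in lborel. (\<lambda>k. p (\<xi> + s /\<^sub>R real (Suc k)) * cutoff_hat s) \<longlonglongrightarrow> p \<xi> * cutoff_hat s"
    proof (intro AE_I2 tendsto_mult tendsto_const)
      fix s :: "real^'n"
      have "(\<lambda>k. \<xi> + s /\<^sub>R real (Suc k)) \<longlonglongrightarrow> \<xi> + 0 *\<^sub>R s"
        by (intro tendsto_intros LIMSEQ_inverse_real_of_nat)
      then show "(\<lambda>k. p (\<xi> + s /\<^sub>R real (Suc k))) \<longlonglongrightarrow> p \<xi>"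
        using continuous_on_tendsto_compose[OF p_cont, of _ \<xi> sequentially] by simp
    qed
    show "AE s in lborel. cmod (p (\<xi> + s /\<^sub>R real (Suc k)) * cutoff_hat s)
        \<le> 2 * C * (1 + (norm \<xi>)\<^sup>2) * ((1 + (norm s)\<^sup>2) * cmod (cutoff_hat s))" for k
      by (intro AE_I2 shifted_product_bound) simp
  qed simp_all
  then show ?thesis by (simp add: integral_cutoff_hat)
qed

end

section \<open>The symbol\<close>

text \<open>Small jumps give the second-order Taylor remainder
  \<open>(\<xi> \<bullet> y)^2 / 2\<close>, large jumps the trivial bound 2. Adding the two
  constants yields one majorant that is locally bounded in \<xi> and integrable for every Levy
  measure.\<close>

lemma levy_integrand_bound:
  fixes \<xi> y :: "real^'n"
  shows "cmod (iexp (\<xi> \<bullet> y) - 1 - \<i> * complex_of_real (\<xi> \<bullet> y) * indicator {y. norm y \<le> 1} y)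
    \<le> (2 + (norm \<xi>)\<^sup>2) * min 1 ((norm y)\<^sup>2)"
proof (cases "norm y \<le> 1")
  case True
  have "(\<xi> \<bullet> y)\<^sup>2 \<le> (norm \<xi>)\<^sup>2 * (norm y)\<^sup>2"
    using Cauchy_Schwarz_ineq[of \<xi> y] by (simp add: power2_norm_eq_inner)
  moreover have "0 \<le> (norm \<xi>)\<^sup>2 * (norm y)\<^sup>2"
    by simp
  moreover have "0 \<le> (norm y)\<^sup>2"
    by simp
  moreover have "(2 + (norm \<xi>)\<^sup>2) * (norm y)\<^sup>2 = 2 * (norm y)\<^sup>2 + (norm \<xi>)\<^sup>2 * (norm y)\<^sup>2"
    by (simp add: distrib_right)
  ultimately have "(\<xi> \<bullet> y)\<^sup>2 / 2 \<le> (2 + (norm \<xi>)\<^sup>2) * (norm y)\<^sup>2"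
    by linarith
  moreover have "min 1 ((norm y)\<^sup>2) = (norm y)\<^sup>2"
    using True by (intro min.absorb2 power_le_one) auto
  ultimately show ?thesis
    using iexp_approx1[of "\<xi> \<bullet> y" 1] True by (simp add: numeral_2_eq_2 algebra_simps)
next
  case False
  then have min1: "min 1 ((norm y)\<^sup>2) = 1"
    by (simp add: min_def one_le_power not_le less_imp_le)
  have "cmod (iexp (\<xi> \<bullet> y) - 1) \<le> 2"
    using norm_triangle_ineq4[of "iexp (\<xi> \<bullet> y)" 1] by simp
  then have "cmod (iexp (\<xi> \<bullet> y) - 1) \<le> (2 + (norm \<xi>)\<^sup>2) * min 1 ((norm y)\<^sup>2)"
    unfolding min1 mult_1_right by (rule add_increasing2[rotated]) simp
  then show ?thesis
    using False by (simp add: indicator_def)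
qed

text \<open>Continuity in \<xi> for fixed x is what makes averages of the symbol near \<xi> converge
  to its value there. A convergent sequence of frequencies is bounded by some R, which fixes a
  majorant for the jump integral.\<close>

lemma levy_khintchine_continuous:
  fixes \<nu> :: "real^'n \<Rightarrow> (real^'n) measure"
  assumes "levy_characteristics a b c \<nu>"
  shows "continuous_on UNIV (levy_khintchine a b c \<nu> x)"
proof -
  have sets[measurable_cong]: "sets (\<nu> x) = sets borel"
    and fin: "(\<integral>\<^sup>+y. ennreal (min 1 ((norm y)\<^sup>2)) \<partial>\<nu> x) < \<infinity>"
    using assms unfolding levy_characteristics_def by blast+
  have int: "integrable (\<nu> x) (\<lambda>y. min 1 ((norm y)\<^sup>2))"
    using fin by (intro integrableI_bounded) auto
  define g where "g \<xi> y = iexp (\<xi> \<bullet> y) - 1 - \<i> * complex_of_real (\<xi> \<bullet> y) * indicator {y. norm y \<le> 1} y"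
    for \<xi> y :: "real^'n"
  have [measurable]: "g \<xi> \<in> borel_measurable (\<nu> x)" for \<xi>
    unfolding g_def by measurable
  have lim: "(\<lambda>k. \<integral>y. g (s k) y \<partial>\<nu> x) \<longlonglongrightarrow> (\<integral>y. g \<xi> y \<partial>\<nu> x)" if s: "s \<longlonglongrightarrow> \<xi>" for s \<xi>
  proof -
    obtain R where R: "\<And>k. norm (s k) \<le> R"
      using convergent_imp_Bseq[OF convergentI[OF s]] by (auto simp: Bseq_def)
    show ?thesis
    proof (rule integral_dominated_convergence[where w = "\<lambda>y. (2 + R\<^sup>2) * min 1 ((norm y)\<^sup>2)"])
      show "AE y in \<nu> x. (\<lambda>k. g (s k) y) \<longlonglongrightarrow> g \<xi> y"
        unfolding g_def by (intro AE_I2 tendsto_intros s)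
      have "cmod (g (s k) y) \<le> (2 + R\<^sup>2) * min 1 ((norm y)\<^sup>2)" for k y
      proof -
        have "(2 + (norm (s k))\<^sup>2) * min 1 ((norm y)\<^sup>2) \<le> (2 + R\<^sup>2) * min 1 ((norm y)\<^sup>2)"
          by (intro mult_right_mono add_left_mono power_mono R) auto
        with levy_integrand_bound[of "s k" y] show ?thesis
          unfolding g_def by linarith
      qed
      then show "AE y in \<nu> x. cmod (g (s k) y) \<le> (2 + R\<^sup>2) * min 1 ((norm y)\<^sup>2)" for k
        by simp
    qed (use int in auto)
  qed
  have "continuous_on UNIV (\<lambda>\<xi>. \<integral>y. g \<xi> y \<partial>\<nu> x)"
    using lim by (auto simp: continuous_on_sequentially comp_def)
  then show ?thesis
    unfolding levy_khintchine_def g_def[symmetric]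
    by (intro continuous_intros linear_continuous_on[OF matrix_vector_mul_bounded_linear])
qed

text \<open>The cosine carries the frequencies \<xi> and -\<xi>; conjugation lets a bound on the
  symbol at \<xi> control both.\<close>

lemma levy_khintchine_minus:
  "levy_khintchine a b c \<nu> x (- \<xi>) = cnj (levy_khintchine a b c \<nu> x \<xi>)"
proof -
  define g where "g \<xi> y = iexp (\<xi> \<bullet> y) - 1 - \<i> * complex_of_real (\<xi> \<bullet> y) * indicator {y. norm y \<le> 1} y"
    for \<xi> y :: "real^'a"
  have "g (- \<xi>) y = cnj (g \<xi> y)" for y
    by (simp add: g_def exp_cnj indicator_def)
  then have "(\<integral>y. g (- \<xi>) y \<partial>\<nu> x) = cnj (\<integral>y. g \<xi> y \<partial>\<nu> x)"
    by simp
  moreover have "c x *v (- \<xi>) = - (c x *v \<xi>)"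
    by (rule linear_neg[OF matrix_vector_mul_linear])
  ultimately show ?thesis
    unfolding levy_khintchine_def g_def[symmetric] by simp
qed

section \<open>Dynkin's formula for the Feller semigroup\<close>

lemma C_infty_measurable: "f \<in> C_infty \<Longrightarrow> f \<in> borel_measurable borel"
  by (auto simp: C_infty_def intro: borel_measurable_continuous_onI)

lemma C_infty_bounded:
  assumes "f \<in> C_infty" obtains B where "\<And>y. \<bar>f y\<bar> \<le> B"
proof -
  have "\<forall>\<^sub>F y in at_infinity. dist (f y) 0 < 1"
    using assms by (intro tendstoD) (auto simp: C_infty_def)
  then obtain b where b: "\<And>y. norm y \<ge> b \<Longrightarrow> \<bar>f y\<bar> < 1"
    by (auto simp: eventually_at_infinity)
  have "bounded (f ` cball 0 b)"
    using assms by (intro compact_imp_bounded compact_continuous_image)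
      (auto simp: C_infty_def intro: continuous_on_subset)
  then obtain K where K: "\<And>y. norm y \<le> b \<Longrightarrow> \<bar>f y\<bar> \<le> K"
    unfolding bounded_iff by (metis imageI mem_cball_0 real_norm_def)
  have "\<bar>f y\<bar> \<le> max K 1" for y
    using b[of y] K[of y] by (cases "norm y \<le> b") auto
  then show thesis by (rule that)
qed

text \<open>\<open>Q \<ge> 0\<close> makes the part of |g| above Q vanish at infinity, so the
  semigroup still acts on it within \<open>C_infty\<close>.\<close>

lemma C_infty_excess:
  assumes "g \<in> C_infty" "Q \<ge> 0" shows "(\<lambda>y. max (\<bar>g y\<bar> - Q) 0) \<in> C_infty"
proof -
  have "((\<lambda>y. max (\<bar>g y\<bar> - Q) 0) \<longlongrightarrow> max (\<bar>0\<bar> - Q) 0) at_infinity"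
    using assms by (intro tendsto_intros) (auto simp: C_infty_def)
  then show ?thesis
    using assms by (auto simp: C_infty_def intro!: continuous_intros)
qed

lemma uniform_limit_at_rightD:
  fixes f :: "real \<Rightarrow> 'a \<Rightarrow> real"
  assumes "uniform_limit UNIV f l (at_right 0)" "e > 0"
  obtains d where "d > 0" "\<And>h x. 0 < h \<Longrightarrow> h < d \<Longrightarrow> \<bar>f h x - l x\<bar> \<le> e"
proof -
  have "\<forall>\<^sub>F h in at_right 0. \<forall>x. dist (f h x) (l x) < e"
    using assms by (auto simp: uniform_limit_iff)
  then show thesis
    using that unfolding eventually_at_right_field dist_real_def by (meson less_imp_le)
qed

section \<open>Transition kernels and the Chapman-Kolmogorov equation\<close>

context
  fixes M :: "'w measure" and P :: "real^'n \<Rightarrow> 'w measure" and F :: "real \<Rightarrow> 'w \<Rightarrow> real^'n"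
  assumes feller: "feller_process M P F"
begin

lemma feller_process_markov: "markov_process M P F"
  using feller by (simp add: feller_process_def)

lemma prob_space_P: "prob_space (P x)"
  and sets_P [measurable_cong]: "sets (P x) = sets M"
  using feller_process_markov unfolding markov_process_def by blast+

lemma space_P: "space (P x) = space M"
  by (rule sets_eq_imp_space_eq[OF sets_P])

lemma
  shows emeasure_P: "emeasure (P x) A = ennreal (measure (P x) A)"
    and integral_P_const: "(\<integral>\<omega>. (c :: real) \<partial>P x) = c"
    and integrable_P_const: "integrable (P x) (\<lambda>\<omega>. c :: real)"
proof -
  interpret prob_space "P x" by (rule prob_space_P)
  show "emeasure (P x) A = ennreal (measure (P x) A)" "(\<integral>\<omega>. c \<partial>P x) = c" "integrable (P x) (\<lambda>\<omega>. c)"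
    by (simp_all add: emeasure_eq_measure prob_space)
qed

lemma integrable_P_bounded:
  fixes f :: "'w \<Rightarrow> 'b::{banach, second_countable_topology}"
  assumes "f \<in> borel_measurable (P x)" "\<And>\<omega>. norm (f \<omega>) \<le> B"
  shows "integrable (P x) f"
  using assms by (intro Bochner_Integration.integrable_bound[OF integrable_P_const[of x B]])
    (auto intro: order_trans[OF _ abs_ge_self])

lemma F_measurable: "t \<ge> 0 \<Longrightarrow> F t \<in> measurable M borel"
  using feller_process_markov unfolding markov_process_def by blast

lemma kernel_measurable:
  "t \<ge> 0 \<Longrightarrow> B \<in> sets borel \<Longrightarrow> (\<lambda>x. measure (P x) (F t -` B \<inter> space M)) \<in> borel_measurable borel"
  using feller_process_markov unfolding markov_process_def by blast

lemma F_measurable_P: "t \<ge> 0 \<Longrightarrow> F t \<in> measurable (P x) borel"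
  using F_measurable by (simp cong: measurable_cong_sets add: sets_P)

definition transition :: "real \<Rightarrow> real^'n \<Rightarrow> (real^'n) measure" where
  "transition t x = distr (P x) borel (F t)"

lemma emeasure_transition:
  assumes "t \<ge> 0" "B \<in> sets borel"
  shows "emeasure (transition t x) B = ennreal (measure (P x) (F t -` B \<inter> space M))"
  using assms F_measurable_P[of t x]
  by (simp add: transition_def emeasure_distr emeasure_P space_P)

lemma transition_measurable:
  assumes "t \<ge> 0" shows "transition t \<in> measurable borel (subprob_algebra borel)"
proof (rule measurable_subprob_algebra)
  show "subprob_space (transition t x)" for x
    unfolding transition_def using F_measurable_P[OF assms]
    by (intro prob_space_imp_subprob_space prob_space.prob_space_distr prob_space_P)
  show "sets (transition t x) = sets borel" for x
    by (simp add: transition_def)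
  show "(\<lambda>x. emeasure (transition t x) B) \<in> borel_measurable borel" if "B \<in> sets borel" for B
    using kernel_measurable[OF assms that] by (simp add: emeasure_transition[OF assms that])
qed

text \<open>Integrate both sides of the Markov property: conditioning on the past preserves the
  expectation of the indicator.\<close>

lemma markov_kernel:
  assumes st: "s \<ge> 0" "t \<ge> 0" and B: "B \<in> sets borel"
  shows "measure (P x) (F (s + t) -` B \<inter> space M)
    = (\<integral>\<omega>. measure (P (F s \<omega>)) (F t -` B \<inter> space M) \<partial>P x)"
proof -
  have "subalgebra (P x) (nat_filtration M F s)"
    unfolding subalgebra_def nat_filtration_def
    using F_measurable by (auto simp: space_P sets_P sets_measure_of_conv
        intro!: sets.sigma_sets_subset intro: measurable_sets)
  then have sub: "sigma_finite_subalgebra (P x) (nat_filtration M F s)"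
    using prob_space.finite_measure[OF prob_space_P]
    by (intro finite_measure_subalgebra_is_sigma_finite finite_measure_subalgebra.intro
        finite_measure_subalgebra_axioms.intro)
  let ?A = "F (s + t) -` B \<inter> space M"
  have A: "?A \<in> sets (P x)"
    unfolding sets_P using measurable_sets[OF F_measurable B, of "s + t"] st by simp
  have int: "integrable (P x) (indicator ?A :: _ \<Rightarrow> real)"
    using A by (intro integrable_P_bounded[where B = 1]) (auto simp: indicator_def)
  have ae: "AE \<omega> in P x. real_cond_exp (P x) (nat_filtration M F s) (indicator ?A) \<omega>
      = measure (P (F s \<omega>)) (F t -` B \<inter> space M)"
    using feller_process_markov st B unfolding markov_process_def by blast
  have meas: "(\<lambda>\<omega>. measure (P (F s \<omega>)) (F t -` B \<inter> space M)) \<in> borel_measurable (P x)"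
    using measurable_compose[OF F_measurable_P[OF st(1)] kernel_measurable[OF st(2) B]] .
  have "measure (P x) ?A = (\<integral>\<omega>. indicator ?A \<omega> \<partial>P x)"
    using A by simp
  also have "\<dots> = (\<integral>\<omega>. real_cond_exp (P x) (nat_filtration M F s) (indicator ?A) \<omega> \<partial>P x)"
    by (rule sigma_finite_subalgebra.real_cond_exp_int(2)[OF sub int, symmetric])
  also have "\<dots> = (\<integral>\<omega>. measure (P (F s \<omega>)) (F t -` B \<inter> space M) \<partial>P x)"
    by (rule integral_cong_AE[OF borel_measurable_cond_exp2 meas ae])
  finally show ?thesis .
qed

text \<open>The form with \<open>\<bind>\<close> lets \<open>integral_bind\<close> carry the
  identity from sets to bounded functions.\<close>

lemma chapman_kolmogorov:
  assumes st: "s \<ge> 0" "t \<ge> 0"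
  shows "transition (s + t) x = transition s x \<bind> transition t"
proof (rule measure_eqI)
  have sets_s: "sets (transition s x) = sets borel"
    by (simp add: transition_def)
  have T: "transition t \<in> measurable (transition s x) (subprob_algebra borel)"
    using transition_measurable[OF st(2)] by (simp cong: measurable_cong_sets add: sets_s)
  have ne: "space (transition s x) \<noteq> {}"
    by (simp add: transition_def)
  show "sets (transition (s + t) x) = sets (transition s x \<bind> transition t)"
    using ne T by (simp add: transition_def sets_bind[where N = borel])
  fix B assume "B \<in> sets (transition (s + t) x)"
  then have B: "B \<in> sets borel" by (simp add: transition_def)
  let ?p = "\<lambda>y. measure (P y) (F t -` B \<inter> space M)"
  note meas = kernel_measurable[OF st(2) B]
  have "emeasure (transition (s + t) x) B = ennreal (\<integral>\<omega>. ?p (F s \<omega>) \<partial>P x)"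
    using st by (simp add: emeasure_transition[OF _ B] markov_kernel[OF st B])
  also have "\<dots> = (\<integral>\<^sup>+\<omega>. ennreal (?p (F s \<omega>)) \<partial>P x)"
    using measurable_compose[OF F_measurable_P[OF st(1)] meas] prob_space.prob_le_1[OF prob_space_P]
    by (intro nn_integral_eq_integral[symmetric] integrable_P_bounded[where B = 1]) simp_all
  also have "\<dots> = (\<integral>\<^sup>+y. ennreal (?p y) \<partial>transition s x)"
    unfolding transition_def
    by (rule nn_integral_distr[OF F_measurable_P[OF st(1)], symmetric]) (use meas in simp)
  also have "\<dots> = emeasure (transition s x \<bind> transition t) B"
    unfolding emeasure_bind[OF ne T B] by (simp only: emeasure_transition[OF st(2) B])
  finally show "emeasure (transition (s + t) x) B = emeasure (transition s x \<bind> transition t) B" .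
qed

section \<open>The semigroup on \<open>C_infty\<close> and its time derivative\<close>

abbreviation "T \<equiv> feller_semigroup P F"

lemma semigroup_eq_transition:
  assumes "t \<ge> 0" "f \<in> borel_measurable borel" shows "T t f x = (\<integral>y. f y \<partial>transition t x)"
  using assms F_measurable_P[of t x]
  by (simp add: feller_semigroup_def transition_def integral_distr)

lemma semigroup_C_infty: "t \<ge> 0 \<Longrightarrow> f \<in> C_infty \<Longrightarrow> T t f \<in> C_infty"
  using feller by (auto simp: feller_process_def)

lemma semigroup_add:
  assumes st: "s \<ge> 0" "t \<ge> 0" and f: "f \<in> C_infty"
  shows "T (s + t) f x = T s (T t f) x"
proof -
  note meas = C_infty_measurable[OF f]
  obtain B where B: "\<And>y. \<bar>f y\<bar> \<le> B" using C_infty_bounded[OF f] by blast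
  have sets_s: "sets (transition s x) = sets borel"
    by (simp add: transition_def)
  have fin: "finite_measure (transition s x)"
    using F_measurable_P[OF st(1)] unfolding transition_def
    by (intro prob_space.finite_measure prob_space.prob_space_distr prob_space_P)
  have "T (s + t) f x = (\<integral>y. f y \<partial>(transition s x \<bind> transition t))"
    using st meas by (simp add: semigroup_eq_transition chapman_kolmogorov)
  also have "\<dots> = (\<integral>z. (\<integral>y. f y \<partial>transition t z) \<partial>transition s x)"
  proof (rule integral_bind[where K = borel and B = B and B' = 1])
    show "transition t \<in> measurable (transition s x) (subprob_algebra borel)"
      using transition_measurable[OF st(2)] by (simp cong: measurable_cong_sets add: sets_s)
    show "AE z in transition s x. emeasure (transition t z) (space (transition t z)) \<le> ennreal 1"
      using prob_space.emeasure_space_1[OF prob_space.prob_space_distr[OF prob_space_P F_measurable_P[OF st(2)]]]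
      by (simp add: transition_def)
  qed (use B fin meas in \<open>auto intro: finite_measure.finite_emeasure_space\<close>)
  also have "\<dots> = T s (T t f) x"
    using st meas C_infty_measurable[OF semigroup_C_infty[OF st(2) f]] by (simp add: semigroup_eq_transition)
  finally show ?thesis .
qed

lemma semigroup_integrable:
  assumes "t \<ge> 0" "f \<in> C_infty" shows "integrable (P x) (\<lambda>\<omega>. f (F t \<omega>))"
proof -
  obtain B where "\<And>y. \<bar>f y\<bar> \<le> B" using C_infty_bounded[OF assms(2)] by blast
  then show ?thesis
    using measurable_compose[OF F_measurable_P[OF assms(1)] C_infty_measurable[OF assms(2)]]
    by (intro integrable_P_bounded[where B = B]) simp_all
qed

lemma semigroup_0: "f \<in> C_infty \<Longrightarrow> T 0 f x = f x"
proof -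
  assume f: "f \<in> C_infty"
  have "AE \<omega> in P x. F 0 \<omega> = x"
    using feller_process_markov unfolding markov_process_def by blast
  then have "AE \<omega> in P x. f (F 0 \<omega>) = f x"
    by (rule eventually_mono) simp
  then have "(\<integral>\<omega>. f (F 0 \<omega>) \<partial>P x) = (\<integral>\<omega>. f x \<partial>P x)"
    using borel_measurable_integrable[OF semigroup_integrable[OF order_refl f]] by (intro integral_cong_AE) simp_all
  then show ?thesis by (simp only: feller_semigroup_def integral_P_const)
qed

lemma semigroup_diff_bound:
  assumes "t \<ge> 0" "f \<in> C_infty" "g \<in> C_infty" "\<And>y. \<bar>f y - g y\<bar> \<le> B"
  shows "\<bar>T t f x - T t g x\<bar> \<le> B"
proof -
  note int = semigroup_integrable[OF assms(1,2)] semigroup_integrable[OF assms(1,3)]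
  have "T t f x - T t g x = (\<integral>\<omega>. f (F t \<omega>) - g (F t \<omega>) \<partial>P x)"
    using int by (simp add: feller_semigroup_def)
  also have "\<bar>\<dots>\<bar> \<le> (\<integral>\<omega>. \<bar>f (F t \<omega>) - g (F t \<omega>)\<bar> \<partial>P x)"
    by (rule integral_abs_bound)
  also have "\<dots> \<le> (\<integral>\<omega>. B \<partial>P x)"
    using int assms(4) by (intro integral_mono integrable_P_const) simp_all
  finally show ?thesis by (simp only: integral_P_const)
qed

lemma semigroup_bound:
  assumes "t \<ge> 0" "f \<in> C_infty" "\<And>y. \<bar>f y\<bar> \<le> B"
  shows "\<bar>T t f x\<bar> \<le> B"
  using semigroup_diff_bound[of t f "\<lambda>_. 0" B x] assms by (simp add: feller_semigroup_def C_infty_def)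

text \<open>Nonzero constants are not in \<open>C_infty\<close>, so Q stays outside the semigroup;
  it passes through because each \<open>P x\<close> has mass one.\<close>

lemma semigroup_mono:
  assumes "t \<ge> 0" "f \<in> C_infty" "g \<in> C_infty" "\<And>y. \<bar>f y\<bar> \<le> Q + g y"
  shows "\<bar>T t f x\<bar> \<le> Q + T t g x"
proof -
  have "\<bar>T t f x\<bar> \<le> (\<integral>\<omega>. \<bar>f (F t \<omega>)\<bar> \<partial>P x)"
    unfolding feller_semigroup_def by (rule integral_abs_bound)
  also have "\<dots> \<le> (\<integral>\<omega>. Q + g (F t \<omega>) \<partial>P x)"
    using semigroup_integrable[OF assms(1,2)] semigroup_integrable[OF assms(1,3)] assms(4)
    by (intro integral_mono Bochner_Integration.integrable_add integrable_P_const) simp_all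
  finally show ?thesis
    using semigroup_integrable[OF assms(1,3)] by (simp add: feller_semigroup_def integrable_P_const prob_space.prob_space[OF prob_space_P])
qed

text \<open>For r < s, \<open>T s f - T r f\<close> is \<open>T r\<close> applied to
  \<open>T (s - r) f - f\<close>. Contraction therefore spreads strong continuity at 0 to all times
  and starting points with the same d.\<close>

lemma semigroup_uniformly_continuous:
  assumes f: "f \<in> C_infty" and "e > 0"
  obtains d where "d > 0"
    "\<And>r s x. 0 \<le> r \<Longrightarrow> 0 \<le> s \<Longrightarrow> \<bar>r - s\<bar> < d \<Longrightarrow> \<bar>T r f x - T s f x\<bar> \<le> e"
proof -
  have "uniform_limit UNIV (\<lambda>t. T t f) f (at_right 0)"
    using feller f by (auto simp: feller_process_def)
  then obtain d where d: "d > 0" "\<And>h x. 0 < h \<Longrightarrow> h < d \<Longrightarrow> \<bar>T h f x - f x\<bar> \<le> e"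
    using \<open>e > 0\<close> by (rule uniform_limit_at_rightD) blast
  have *: "\<bar>T s f x - T r f x\<bar> \<le> e" if rs: "0 \<le> r" "r < s" "s - r < d" for r s x
  proof -
    have "\<bar>T r (T (s - r) f) x - T r f x\<bar> \<le> e"
      using rs f d(2)[of "s - r"] by (intro semigroup_diff_bound semigroup_C_infty) auto
    then show ?thesis using semigroup_add[of r "s - r" f x] rs f by simp
  qed
  show thesis
  proof (rule that[OF d(1)])
    fix r s :: real and x assume "0 \<le> r" "0 \<le> s" "\<bar>r - s\<bar> < d"
    then show "\<bar>T r f x - T s f x\<bar> \<le> e"
      using *[of r s x] *[of s r x] \<open>e > 0\<close> by (cases r s rule: linorder_cases) auto
  qed
qed

lemma semigroup_continuous_on:
  assumes "f \<in> C_infty" shows "continuous_on {0..t} (\<lambda>s. T s f x)"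
  unfolding continuous_on_iff
proof (intro ballI allI impI)
  fix s e :: real assume s: "s \<in> {0..t}" and "e > 0"
  then obtain d where d: "d > 0"
    "\<And>r s x. 0 \<le> r \<Longrightarrow> 0 \<le> s \<Longrightarrow> \<bar>r - s\<bar> < d \<Longrightarrow> \<bar>T r f x - T s f x\<bar> \<le> e / 2"
    using semigroup_uniformly_continuous[OF assms, of "e / 2"] by auto
  show "\<exists>d>0. \<forall>r\<in>{0..t}. dist r s < d \<longrightarrow> dist (T r f x) (T s f x) < e"
  proof (intro exI[of _ d] conjI ballI impI)
    fix r assume "r \<in> {0..t}" "dist r s < d"
    then have "\<bar>T r f x - T s f x\<bar> \<le> e / 2"
      using s by (intro d) (auto simp: dist_real_def)
    then show "dist (T r f x) (T s f x) < e" using \<open>e > 0\<close> by (simp add: dist_real_def)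
  qed (rule d(1))
qed

text \<open>The generator provides only a right derivative at time 0. Applying \<open>T u\<close>
  moves it to time u. For the left derivative at s, the quotient is based at the moving time r, so
  its limit is first compared with \<open>T r g\<close> and then, by uniform continuity, with
  \<open>T s g\<close>; each comparison costs e/3.\<close>

lemma semigroup_has_derivative:
  assumes gen: "has_generator P F f g" and s: "s \<in> {0..t}"
  shows "((\<lambda>s. T s f x) has_real_derivative T s g x) (at s within {0..t})"
  unfolding has_field_derivative_iff Lim_within
proof (intro allI impI)
  have f: "f \<in> C_infty" and g: "g \<in> C_infty"
    and lim: "uniform_limit UNIV (\<lambda>t x. (T t f x - f x) / t) g (at_right 0)"
    using gen by (auto simp: has_generator_def)
  fix e :: real assume "e > 0"
  then have e3: "e / 3 > 0" by simp
  obtain d1 where d1: "d1 > 0" "\<And>h x. 0 < h \<Longrightarrow> h < d1 \<Longrightarrow> \<bar>(T h f x - f x) / h - g x\<bar> \<le> e / 3"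
    using uniform_limit_at_rightD[OF lim e3] by blast
  obtain d2 where d2: "d2 > 0"
    "\<And>r s x. 0 \<le> r \<Longrightarrow> 0 \<le> s \<Longrightarrow> \<bar>r - s\<bar> < d2 \<Longrightarrow> \<bar>T r g x - T s g x\<bar> \<le> e / 3"
    using semigroup_uniformly_continuous[OF g e3] by blast
  have quot: "\<bar>(T r f x - T u f x) / (r - u) - T u g x\<bar> \<le> e / 3" if "0 \<le> u" "u < r" "r - u < d1" for u r
  proof -
    define h where "h = r - u"
    have h: "0 < h" "h < d1" using that by (auto simp: h_def)
    note int = semigroup_integrable[OF \<open>0 \<le> u\<close>]
    define D where "D y = (T h f y - f y) / h - g y" for y
    have int_D: "integrable (P x) (\<lambda>\<omega>. D (F u \<omega>))"
      unfolding D_def using int[OF f] int[OF g] int[OF semigroup_C_infty[of h f]] f h by simp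
    have "(T r f x - T u f x) / (r - u) - T u g x = (\<integral>\<omega>. D (F u \<omega>) \<partial>P x)"
      using int[OF f] int[OF g] int[OF semigroup_C_infty[of h f]] f h that semigroup_add[of u h f x]
      by (simp add: feller_semigroup_def h_def D_def)
    moreover have "\<bar>\<integral>\<omega>. D (F u \<omega>) \<partial>P x\<bar> \<le> (\<integral>\<omega>. \<bar>D (F u \<omega>)\<bar> \<partial>P x)"
      by (rule integral_abs_bound)
    moreover have "(\<integral>\<omega>. \<bar>D (F u \<omega>)\<bar> \<partial>P x) \<le> (\<integral>\<omega>. e / 3 \<partial>P x)"
      using int_D d1(2)[OF h] by (intro integral_mono integrable_P_const) (simp_all add: D_def)
    moreover have "(\<integral>\<omega>. e / 3 \<partial>P x) = e / 3"
      by (rule integral_P_const)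
    ultimately show ?thesis by linarith
  qed
  show "\<exists>d>0. \<forall>r\<in>{0..t}. 0 < dist r s \<and> dist r s < d \<longrightarrow>
      dist ((T r f x - T s f x) / (r - s)) (T s g x) < e"
  proof (intro exI[of _ "min d1 d2"] conjI ballI impI)
    fix r assume r: "r \<in> {0..t}" "0 < dist r s \<and> dist r s < min d1 d2"
    show "dist ((T r f x - T s f x) / (r - s)) (T s g x) < e"
    proof (cases "s < r")
      case True
      then show ?thesis
        using quot[of s r] s r \<open>e > 0\<close> by (auto simp: dist_real_def)
    next
      case False
      then have "\<bar>(T s f x - T r f x) / (s - r) - T r g x\<bar> \<le> e / 3"
        using s r by (intro quot) (auto simp: dist_real_def)
      moreover have "\<bar>T r g x - T s g x\<bar> \<le> e / 3"
        using s r by (intro d2) (auto simp: dist_real_def)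
      moreover have "(T r f x - T s f x) / (r - s) = (T s f x - T r f x) / (s - r)"
        by (metis minus_diff_eq minus_divide_divide)
      ultimately show ?thesis
        using \<open>e > 0\<close> unfolding dist_real_def by linarith
    qed
  qed (use d1 d2 in simp)
qed

lemma dynkin_formula:
  assumes gen: "has_generator P F f g" and "t \<ge> 0"
  shows "T t f x - f x = integral {0..t} (\<lambda>s. T s g x)"
proof -
  have "((\<lambda>s. T s g x) has_integral (T t f x - T 0 f x)) {0..t}"
    using semigroup_has_derivative[OF gen] \<open>t \<ge> 0\<close>
    by (intro fundamental_theorem_of_calculus)
       (auto simp flip: has_real_derivative_iff_has_vector_derivative)
  then show ?thesis
    using gen by (simp add: semigroup_0 has_generator_def integral_unique)
qed

text \<open>K may exceed Q and the convergence of \<open>g k\<close> is only pointwise, so Q cannot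
  be inserted before the limit. Instead \<open>|g k| \<le> Q + h k\<close>, where the excess
  \<open>h k\<close> tends to 0 and stays below K. Dominated convergence, under \<open>P x\<close>
  and then in time, removes it. The semigroup acts on \<open>h k\<close> in \<open>C_infty\<close>,
  not on \<open>\<gamma>\<close>, so every time integrand is continuous.\<close>

lemma dynkin_limit_bound:
  assumes gen: "\<And>k. has_generator P F (f k) (g k)" and "t \<ge> 0" "Q \<ge> 0"
    and f_bound: "\<And>k y. \<bar>f k y\<bar> \<le> B" and f_lim: "\<And>y. (\<lambda>k. f k y) \<longlonglongrightarrow> \<phi> y"
    and g_bound: "\<And>k y. \<bar>g k y\<bar> \<le> K"
    and g_lim: "\<And>y. (\<lambda>k. g k y) \<longlonglongrightarrow> \<gamma> y" and \<gamma>: "\<And>y. \<bar>\<gamma> y\<bar> \<le> Q"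
    and \<phi>: "\<phi> \<in> borel_measurable borel"
  shows "\<bar>(\<integral>\<omega>. \<phi> (F t \<omega>) \<partial>P x) - \<phi> x\<bar> \<le> t * Q"
proof -
  have f: "f k \<in> C_infty" and g: "g k \<in> C_infty" for k
    using gen by (auto simp: has_generator_def)
  define h where "h k y = max (\<bar>g k y\<bar> - Q) 0" for k y
  have h: "h k \<in> C_infty" for k
    unfolding h_def using C_infty_excess[OF g \<open>Q \<ge> 0\<close>] by simp
  have K: "K \<ge> 0" using order_trans[OF abs_ge_zero g_bound] .
  have h_bound: "\<bar>h k y\<bar> \<le> K" for k y
    using g_bound[of k y] K \<open>Q \<ge> 0\<close> by (auto simp: h_def)
  have h_lim: "(\<lambda>k. h k y) \<longlonglongrightarrow> 0" for y
  proof -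
    have "(\<lambda>k. h k y) \<longlonglongrightarrow> max (\<bar>\<gamma> y\<bar> - Q) 0"
      unfolding h_def by (intro tendsto_intros g_lim)
    then show ?thesis using \<gamma>[of y] by (simp add: max_def)
  qed
  have Th_lim: "(\<lambda>k. T s (h k) x) \<longlonglongrightarrow> 0" if "s \<ge> 0" for s
  proof -
    have "(\<lambda>k. \<integral>\<omega>. h k (F s \<omega>) \<partial>P x) \<longlonglongrightarrow> (\<integral>\<omega>. 0 \<partial>P x)"
      using borel_measurable_integrable[OF semigroup_integrable[OF that h]] h_lim h_bound
      by (intro integral_dominated_convergence[where w = "\<lambda>_. K"] integrable_P_const) simp_all
    then show ?thesis by (simp add: feller_semigroup_def)
  qed
  have int: "(\<lambda>s. T s u x) integrable_on {0..t}" if "u \<in> C_infty" for u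
    by (rule integrable_continuous_interval[OF semigroup_continuous_on[OF that]])
  have "(\<lambda>k. integral {0..t} (\<lambda>s. T s (h k) x)) \<longlonglongrightarrow> integral {0..t} (\<lambda>s. 0)"
    using Th_lim h_bound by (intro dominated_convergence(2)[where h = "\<lambda>_. K"] int h) (auto intro!: semigroup_bound h)
  then have lim1: "(\<lambda>k. t * Q + integral {0..t} (\<lambda>s. T s (h k) x)) \<longlonglongrightarrow> t * Q + 0"
    by (intro tendsto_intros) simp
  have "(\<lambda>k. T t (f k) x) \<longlonglongrightarrow> (\<integral>\<omega>. \<phi> (F t \<omega>) \<partial>P x)"
    unfolding feller_semigroup_def
    using borel_measurable_integrable[OF semigroup_integrable[OF \<open>t \<ge> 0\<close> f]] f_lim f_bound
      measurable_compose[OF F_measurable_P[OF \<open>t \<ge> 0\<close>] \<phi>]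
    by (intro integral_dominated_convergence[where w = "\<lambda>_. B"] integrable_P_const) simp_all
  then have lim2: "(\<lambda>k. \<bar>T t (f k) x - f k x\<bar>) \<longlonglongrightarrow> \<bar>(\<integral>\<omega>. \<phi> (F t \<omega>) \<partial>P x) - \<phi> x\<bar>"
    by (intro tendsto_intros f_lim)
  have "\<bar>T t (f k) x - f k x\<bar> \<le> t * Q + integral {0..t} (\<lambda>s. T s (h k) x)" for k
  proof -
    have "\<bar>T t (f k) x - f k x\<bar> = norm (integral {0..t} (\<lambda>s. T s (g k) x))"
      by (simp add: dynkin_formula[OF gen \<open>t \<ge> 0\<close>])
    also have "\<dots> \<le> integral {0..t} (\<lambda>s. Q + T s (h k) x)"
      by (intro integral_norm_bound_integral integrable_add int g h integrable_const_ivl)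
         (auto intro!: semigroup_mono g h simp: h_def)
    also have "\<dots> = t * Q + integral {0..t} (\<lambda>s. T s (h k) x)"
      using int[OF h] \<open>t \<ge> 0\<close> by (subst Henstock_Kurzweil_Integration.integral_add) auto
    finally show ?thesis .
  qed
  then show ?thesis
    using LIMSEQ_le[OF lim2 lim1] by auto
qed

end

section \<open>From the generator to the characteristic function\<close>

lemma has_generator_generator:
  assumes "f \<in> generator_domain P F"
  shows "has_generator P F f (generator P F f)"
proof -
  obtain g where g: "has_generator P F f g"
    using assms by (auto simp: generator_domain_def)
  have "g' = g" if "has_generator P F f g'" for g'
  proof
    fix x
    have "((\<lambda>t. (feller_semigroup P F t f x - f x) / t) \<longlongrightarrow> g x) (at_right 0)"
      "((\<lambda>t. (feller_semigroup P F t f x - f x) / t) \<longlongrightarrow> g' x) (at_right 0)"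
      using g that by (auto simp: has_generator_def intro: tendsto_uniform_limitI)
    then show "g' x = g x"
      by (intro tendsto_unique[OF trivial_limit_at_right_real])
  qed
  with g have "generator P F f = g"
    unfolding generator_def by (intro the_equality)
  with g show ?thesis by simp
qed

text \<open>\<open>(1 - u)(1 + 2u) = 1 + u(1 - 2u)\<close> is at least 1 on this range, and
  \<open>1 + 2u \<le> exp(2u)\<close>. This is the origin of the factor 2 in the theorem.\<close>

lemma one_minus_ge_exp:
  fixes u :: real
  assumes "0 \<le> u" "u \<le> 1 / 2" shows "exp (- (2 * u)) \<le> 1 - u"
proof -
  have "1 \<le> (1 - u) * (1 + 2 * u)"
    using assms mult_left_mono[of u "1/2" u] by (simp add: algebra_simps)
  also have "\<dots> \<le> (1 - u) * exp (2 * u)"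
    using assms by (intro mult_left_mono exp_ge_add_one_self) auto
  finally show ?thesis
    by (simp add: exp_minus field_simps)
qed

lemma nice_feller_char_fun_bound:
  fixes P :: "real^'n \<Rightarrow> 'w measure"
  assumes nice: "nice_feller_process M P F q"
    and Q: "\<And>z. cmod (q z \<xi>) \<le> Q" and "t \<ge> 0"
  shows "\<bar>Re (char_fun P F t x \<xi>) - 1\<bar> \<le> t * Q"
proof -
  have feller: "feller_process M P F" and dom: "C_c_smooth \<subseteq> generator_domain P F" and symb: "is_symbol P F q"
    using nice unfolding nice_feller_process_def by blast+
  obtain C where C: "\<And>\<eta> z. cmod (q z \<eta>) \<le> C * (1 + (norm \<eta>)\<^sup>2)"
    using nice by (auto simp: nice_feller_process_def)
  obtain a b c \<nu> where levy: "levy_characteristics a b c \<nu>" and q: "\<And>z. q z = levy_khintchine a b c \<nu> z"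
    using symb by (auto simp: is_symbol_def fun_eq_iff)
  have Q0: "Q \<ge> 0" using order_trans[OF norm_ge_zero Q[of 0]] .
  have Q': "cmod (q z (- \<xi>)) \<le> Q" for z
    using Q[of z] by (simp add: q levy_khintchine_minus)
  define W where "W = 2 * C * (1 + (norm \<xi>)\<^sup>2) * (\<integral>s. (1 + (norm s)\<^sup>2) * cmod (cutoff_hat (s :: real^'n)) \<partial>lborel)"
  \<comment> \<open>The cosine is centred at the starting point and the cut-offs at the origin; the
    phase records the difference. It makes the cosine equal to 1 at x and its expectation equal to
    the real part of the characteristic function.\<close>
  define \<theta> where "\<theta> = - (\<xi> \<bullet> x)"
  \<comment> \<open>Radius k + 1 keeps the scale at least 1, as the majorant for the approximate
    identity requires.\<close>
  define f where "f k y = cos (\<xi> \<bullet> y + \<theta>) * cutoff (real (Suc k)) y" for k y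
  \<comment> \<open>The unimodular factor is absorbed into the symbol, so the growth constant C
    remains valid for every z.\<close>
  define p where "p z \<eta> = q z \<eta> * iexp (\<eta> \<bullet> z)" for z \<eta>
  have p_cont: "continuous_on UNIV (p z)" for z
    unfolding p_def q by (intro continuous_intros levy_khintchine_continuous[OF levy])
  have p_bound: "cmod (p z \<eta>) \<le> C * (1 + (norm \<eta>)\<^sup>2)" for z \<eta>
    using C by (simp add: p_def norm_mult)
  define J where "J k \<zeta> z = (\<integral>s. p z (\<zeta> + s /\<^sub>R real (Suc k)) * cutoff_hat s \<partial>lborel)" for k \<zeta> z
  have f_smooth: "f k \<in> C_c_smooth" for k
    unfolding f_def by (rule cos_cutoff_in_C_c_smooth) simp
  then have gen: "has_generator P F (f k) (generator P F (f k))" for k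
    using dom by (intro has_generator_generator) auto
  \<comment> \<open>The Fourier representation splits at \<xi> and -\<xi>; after rescaling, each
    half is an average of \<open>p z\<close> near that frequency with weight
    \<open>cutoff_hat\<close>.\<close>
  have gen_eq: "complex_of_real (generator P F (f k) z)
      = - (iexp \<theta> / 2 * J k \<xi> z + iexp (- \<theta>) / 2 * J k (- \<xi>) z)" for k z
  proof -
    let ?D = "\<lambda>\<zeta> \<eta>. complex_of_real (real (Suc k) ^ CARD('n)) * cutoff_hat (real (Suc k) *\<^sub>R (\<eta> - \<zeta>))"
    have "q z \<eta> * iexp (\<eta> \<bullet> z) * fourier (f k) \<eta>
        = iexp \<theta> / 2 * (p z \<eta> * ?D \<xi> \<eta>) + iexp (- \<theta>) / 2 * (p z \<eta> * ?D (- \<xi>) \<eta>)" for \<eta>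
    proof -
      have "u * (a * x + b * y) = a * (u * x) + b * (u * y)" for u a x b y :: complex
        by (simp add: algebra_simps)
      moreover have "real (Suc k) > 0" by simp
      ultimately show ?thesis
        unfolding f_def by (simp only: fourier_cos_cutoff p_def)
    qed
    moreover have "integrable lborel (\<lambda>\<eta>. p z \<eta> * ?D \<zeta> \<eta>)"
      "(\<integral>\<eta>. p z \<eta> * ?D \<zeta> \<eta> \<partial>lborel) = J k \<zeta> z" for \<zeta>
      using approx_identity_integral[OF p_cont p_bound, of "real (Suc k)" z \<zeta>] by (simp_all add: J_def)
    ultimately have "(\<integral>\<eta>. q z \<eta> * iexp (\<eta> \<bullet> z) * fourier (f k) \<eta> \<partial>lborel)
        = iexp \<theta> / 2 * J k \<xi> z + iexp (- \<theta>) / 2 * J k (- \<xi>) z"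
      by (simp only: Bochner_Integration.integral_add integrable_mult_right integral_mult_right_zero)
    then show ?thesis
      using symb f_smooth[of k] unfolding is_symbol_def by simp
  qed
  have J_bound: "cmod (J k \<zeta> z) \<le> W" if "norm \<zeta> = norm \<xi>" for k \<zeta> z
    using approx_identity_bound[OF p_cont p_bound, of "real (Suc k)" z \<zeta>] that
    by (simp add: J_def W_def)
  have J_lim: "(\<lambda>k. J k \<zeta> z) \<longlonglongrightarrow> p z \<zeta>" for \<zeta> z
    unfolding J_def by (rule approx_identity_tendsto[OF p_cont p_bound])
  \<comment> \<open>Both coefficients have modulus 1/2, so a common bound survives: W for the
    approximations, Q for the limit.\<close>
  have half: "cmod (- (iexp \<theta> / 2 * u + iexp (- \<theta>) / 2 * v)) \<le> R" if "cmod u \<le> R" "cmod v \<le> R" for u v R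
  proof -
    have "cmod (- (iexp \<theta> / 2 * u + iexp (- \<theta>) / 2 * v)) \<le> cmod (iexp \<theta> / 2 * u) + cmod (iexp (- \<theta>) / 2 * v)"
      by (simp only: norm_minus_cancel norm_triangle_ineq)
    also have "\<dots> = cmod u / 2 + cmod v / 2"
      by (simp only: norm_mult norm_divide norm_exp_i_times) simp
    finally show ?thesis using that by linarith
  qed
  \<comment> \<open>By conjugate symmetry this is
    \<open>- Re (q z \<xi> * iexp (\<xi> \<bullet> (z - x)))\<close>, the formal generator of the
    cosine. The real part is taken because the generators converging to it are real.\<close>
  define \<gamma> where "\<gamma> z = Re (- (iexp \<theta> / 2 * p z \<xi> + iexp (- \<theta>) / 2 * p z (- \<xi>)))" for z
  have "\<bar>(\<integral>\<omega>. cos (\<xi> \<bullet> F t \<omega> + \<theta>) \<partial>P x) - cos (\<xi> \<bullet> x + \<theta>)\<bar> \<le> t * Q"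
  proof (rule dynkin_limit_bound[OF feller gen \<open>t \<ge> 0\<close> Q0])
    show "\<bar>f k y\<bar> \<le> 1" for k y
      using mult_mono[OF abs_cos_le_one[of "\<xi> \<bullet> y + \<theta>"] cutoff_bounds(2)[of "real (Suc k)" y]]
        cutoff_bounds(1)[of "real (Suc k)" y]
      by (simp add: f_def abs_mult)
    show "(\<lambda>k. f k y) \<longlonglongrightarrow> cos (\<xi> \<bullet> y + \<theta>)" for y
      using tendsto_mult[OF tendsto_const cutoff_tendsto] by (simp add: f_def)
    show "\<bar>generator P F (f k) y\<bar> \<le> W" for k y
      using half[OF J_bound[of \<xi> k y] J_bound[of "- \<xi>" k y]] unfolding gen_eq[symmetric] by simp
    show "(\<lambda>k. generator P F (f k) y) \<longlonglongrightarrow> \<gamma> y" for y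
    proof -
      have "(\<lambda>k. Re (complex_of_real (generator P F (f k) y))) \<longlonglongrightarrow> \<gamma> y"
        unfolding gen_eq \<gamma>_def by (intro tendsto_intros J_lim)
      then show ?thesis by simp
    qed
    show "\<bar>\<gamma> y\<bar> \<le> Q" for y
      unfolding \<gamma>_def using Q Q'
      by (intro order_trans[OF abs_Re_le_cmod half]) (auto simp: p_def norm_mult)
  qed measurable
  moreover have "Re (char_fun P F t x \<xi>) = (\<integral>\<omega>. cos (\<xi> \<bullet> F t \<omega> + \<theta>) \<partial>P x)"
  proof -
    have [measurable]: "F t \<in> measurable (P x) borel" by (rule F_measurable_P[OF feller \<open>t \<ge> 0\<close>])
    have "complex_integrable (P x) (\<lambda>\<omega>. iexp (\<xi> \<bullet> (F t \<omega> - x)))"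
      by (intro integrable_P_bounded[OF feller, where B = 1]) simp_all
    from integral_Re[OF this] show ?thesis
      by (simp add: char_fun_def \<theta>_def inner_diff_right Re_exp)
  qed
  ultimately show ?thesis by (simp add: \<theta>_def)
qed

theorem lemma2p2:
  fixes M :: "'w measure"
    and P :: "real^'n \<Rightarrow> 'w measure"
    and F :: "real \<Rightarrow> 'w \<Rightarrow> real^'n"
    and q :: "real^'n \<Rightarrow> real^'n \<Rightarrow> complex"
  assumes "nice_feller_process M P F q"
  shows "\<forall>\<epsilon>>0. \<forall>\<xi>. \<exists>t0>0. \<forall>x. \<forall>t\<in>{0..t0}.
    Re (char_fun P F t x \<xi>) \<ge> exp (- ((2 + \<epsilon>) * t * (SUP z. cmod (q z \<xi>))))"
proof (intro allI impI)
  fix \<epsilon> :: real and \<xi> :: "real^'n" assume "\<epsilon> > 0"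
  define Q where "Q = (SUP z. cmod (q z \<xi>))"
  obtain C where "\<forall>\<eta> z. cmod (q z \<eta>) \<le> C * (1 + (norm \<eta>)\<^sup>2)"
    using assms by (auto simp: nice_feller_process_def)
  \<comment> \<open>Quadratic growth at the fixed \<xi> makes the supremum a genuine upper bound; on
    an unbounded set of reals \<open>SUP\<close> would guarantee nothing.\<close>
  then have "bdd_above (range (\<lambda>z. cmod (q z \<xi>)))"
    by (intro bdd_aboveI2[where M = "C * (1 + (norm \<xi>)\<^sup>2)"]) simp
  then have Q: "cmod (q z \<xi>) \<le> Q" for z
    unfolding Q_def by (rule cSUP_upper[OF UNIV_I])
  have Q0: "Q \<ge> 0" using order_trans[OF norm_ge_zero Q[of 0]] .
  note bound = nice_feller_char_fun_bound[OF assms Q]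
  show "\<exists>t0>0. \<forall>x. \<forall>t\<in>{0..t0}.
      Re (char_fun P F t x \<xi>) \<ge> exp (- ((2 + \<epsilon>) * t * (SUP z. cmod (q z \<xi>))))"
  \<comment> \<open>The choice gives \<open>t * Q \<le> 1/2\<close>, the range of
    \<open>one_minus_ge_exp\<close>; the added 1 keeps the time positive when Q = 0.\<close>
  proof (intro exI[of _ "1 / (2 * (Q + 1))"] conjI allI ballI)
    show "0 < 1 / (2 * (Q + 1))" using Q0 by simp
    fix x t assume "t \<in> {0..1 / (2 * (Q + 1))}"
    then have t: "0 \<le> t" "t \<le> 1 / (2 * (Q + 1))" by auto
    have "t * Q \<le> 1 / (2 * (Q + 1)) * Q" using t(2) Q0 by (rule mult_right_mono)
    also have "\<dots> \<le> 1 / 2" using Q0 by (simp add: field_simps)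
    finally have tQ: "t * Q \<le> 1 / 2" .
    have "0 \<le> \<epsilon> * (t * Q)" using \<open>\<epsilon> > 0\<close> t(1) Q0 by simp
    then have "exp (- ((2 + \<epsilon>) * t * Q)) \<le> exp (- (2 * (t * Q)))"
      by (simp add: algebra_simps)
    also have "\<dots> \<le> 1 - t * Q"
      using t(1) Q0 tQ by (intro one_minus_ge_exp) auto
    also have "\<dots> \<le> Re (char_fun P F t x \<xi>)"
      using bound[OF t(1), of x] by linarith
    finally show "Re (char_fun P F t x \<xi>) \<ge> exp (- ((2 + \<epsilon>) * t * (SUP z. cmod (q z \<xi>))))"
      by (simp only: Q_def)
  qed
qed

end
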